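(* Assume that $A\cap\operatorname{dom} f=\emptyset$ and let $x^{*}\in X^{*}$. The following statements are equivalent: (i) $\operatorname{epi}(f+\delta_A)^{*}\cap(\{x^{*}\}\times\mathbb{R})\neq\overline{\operatorname{epi} f^{*}+K}\cap(\{x^{*}\}\times\mathbb{R})$; (ii) $\{x^{*}\}\times\mathbb{R}\nsubseteq\overline{\operatorname{epi} f^{*}+K}$; (iii) $x^{*}\notin\overline{\operatorname{dom} f^{*}+\operatorname{cone}\Omega+\operatorname{barr} C}$; (iv) there exists $d\in\bigcap_{i\in I}[f_i^{\infty}\le 0]\cap C^{\infty}$ such that $f^{\infty}(d)<\langle x^{*},d\rangle$. Moreover, if $A\neq\emptyset$, then (i)–(iv) are also equivalent to (v) there exists $d\in A^{\infty}$ such that $f^{\infty}(d)<\langle x^{*},d\rangle$.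
   Context: $X$ is a real locally convex Hausdorff topological vector space with topological dual $X^{*}$. $X^{*}$ carries the weak$^{*}$ topology, $X^{*}\times\mathbb{R}$ the corresponding product topology, and $\overline{E}$ denotes closure of $E$ in these topologies. $\Gamma(X)$ is the set of proper (never $-\infty$, not identically $+\infty$) lower semicontinuous convex functions $X\to\mathbb{R}\cup\{+\infty\}$. Data: $I$ is an arbitrary (possibly infinite) index set, $C\subset X$ is a nonempty closed convex set, $f_i\in\Gamma(X)$ for each $i\in I$, and $f\in\Gamma(X)$. $A:=\{x\in C: f_i(x)\le 0\ \forall i\in I\}$ (possibly empty). Notation: $\operatorname{dom} h=\{h<+\infty\}$; $\operatorname{epi} h=\{(x,r): r\in\mathbb{R},\ h(x)\le r\}$; $h^{*}(x^{*})=\sup_{x\in X}(\langle x^{*},x\rangle-h(x))$, with values in $\mathbb{R}\cup\{\pm\infty\}$ (so the conjugate of the function identically $+\infty$ is identically $-\infty$); $[h\le r]=\{x: h(x)\le r\}$; $\delta_D$ is the indicator of $D$ ($0$ on $D$, $+\infty$ elsewhere; $\delta_\emptyset\equiv+\infty$); $\operatorname{barr} C=\operatorname{dom}\delta_C^{*}$; $\operatorname{cone} D$ is the convex cone generated by $D\cup\{0\}$. Moreover $$K:=\operatorname{cone}\Big(\operatorname{epi}\delta_C^{*}\cup\bigcup_{i\in I}\operatorname{epi} f_i^{*}\Big)\subset X^{*}\times\mathbb{R},\qquad \Omega:=\bigcup_{i\in I}\operatorname{dom} f_i^{*}\subset X^{*}.$$ The recession cone of a nonempty closed convex set $D$ is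 $D^{\infty}=\bigcap_{t>0}t(D-a)$ for any $a\in D$ (independent of $a$). The recession function of $h\in\Gamma(X)$ is $h^{\infty}:X\to\mathbb{R}\cup\{+\infty\}$ defined by $\operatorname{epi}(h^{\infty})=(\operatorname{epi} h)^{\infty}$. *)

theory Defs
  imports "HOL-Analysis.Analysis"
begin

class real_tvs = real_vector + topological_ab_group_add +
  assumes tendsto_scaleR_Pair:
    "LIM p (nhds c \<times>\<^sub>F nhds x). fst p *\<^sub>R snd p :> nhds (c *\<^sub>R x)"

text \<open>
  The quantified formula below is \<^const>\<open>convex\<close> written out: that constant is
  not available on the type parameter of a class specification.
\<close>

class locally_convex_t2 = real_tvs + t2_space +
  assumes convex_nhds_0:
    "open U \<Longrightarrow> 0 \<in> U \<Longrightarrow> \<exists>V. open V \<and>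
      (\<forall>x\<in>V. \<forall>y\<in>V. \<forall>u\<ge>0. \<forall>v\<ge>0. u + v = 1 \<longrightarrow> u *\<^sub>R x + v *\<^sub>R y \<in> V) \<and>
      0 \<in> V \<and> V \<subseteq> U"

lemma tendsto_scaleR_tvs:
  fixes g :: "'b \<Rightarrow> 'a::real_tvs"
  assumes "(f \<longlongrightarrow> c) F" "(g \<longlongrightarrow> x) F"
  shows "((\<lambda>z. f z *\<^sub>R g z) \<longlongrightarrow> c *\<^sub>R x) F"
  using filterlim_compose[OF tendsto_scaleR_Pair filterlim_Pair[OF assms]] by simp

instance real_normed_vector \<subseteq> real_tvs
proof
  fix c :: real and x :: 'a
  have "(fst \<longlongrightarrow> c) (nhds c \<times>\<^sub>F nhds x)" "(snd \<longlongrightarrow> x) (nhds c \<times>\<^sub>F nhds x)"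
    by (rule filterlim_fst filterlim_snd)+
  then show "LIM p (nhds c \<times>\<^sub>F nhds x). fst p *\<^sub>R snd p :> nhds (c *\<^sub>R x)"
    by (rule tendsto_scaleR)
qed

instance real_normed_vector \<subseteq> locally_convex_t2
proof
  fix U :: "'a set"
  assume "open U" "0 \<in> U"
  then obtain e where "e > 0" "ball 0 e \<subseteq> U"
    by (auto simp: open_contains_ball)
  then have "open (ball 0 e) \<and> convex (ball (0::'a) e) \<and> 0 \<in> ball (0::'a) e \<and> ball 0 e \<subseteq> U"
    by simp
  then show "\<exists>V. open V \<and>
      (\<forall>x\<in>V. \<forall>y\<in>V. \<forall>u\<ge>0. \<forall>v\<ge>0. u + v = 1 \<longrightarrow> u *\<^sub>R x + v *\<^sub>R y \<in> V) \<and>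
      0 \<in> V \<and> V \<subseteq> U"
    unfolding convex_def by blast
qed

typedef (overloaded) 'a dual = "{\<phi> :: 'a::real_tvs \<Rightarrow> real. linear \<phi> \<and> continuous_on UNIV \<phi>}"
  morphisms dual_apply Abs_dual
  by (intro exI[of _ "\<lambda>_. 0"]) (auto simp: linear_iff)

setup_lifting type_definition_dual

instantiation dual :: (real_tvs) real_vector
begin

lift_definition zero_dual :: "'a dual" is "\<lambda>_. 0"
  by (auto simp: linear_iff)

lift_definition plus_dual :: "'a dual \<Rightarrow> 'a dual \<Rightarrow> 'a dual" is "\<lambda>\<phi> \<psi> x. \<phi> x + \<psi> x"
  by (auto simp: linear_iff algebra_simps intro!: continuous_intros)

lift_definition uminus_dual :: "'a dual \<Rightarrow> 'a dual" is "\<lambda>\<phi> x. - \<phi> x"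
  by (auto simp: linear_iff intro!: continuous_intros)

lift_definition minus_dual :: "'a dual \<Rightarrow> 'a dual \<Rightarrow> 'a dual" is "\<lambda>\<phi> \<psi> x. \<phi> x - \<psi> x"
  by (auto simp: linear_iff algebra_simps intro!: continuous_intros)

lift_definition scaleR_dual :: "real \<Rightarrow> 'a dual \<Rightarrow> 'a dual" is "\<lambda>c \<phi> x. c * \<phi> x"
  by (auto simp: linear_iff algebra_simps intro!: continuous_intros)

instance
  by standard (transfer, simp add: fun_eq_iff algebra_simps)+

end

text \<open>
  The topology of pointwise convergence: the topology induced from the product
  topology on \<^typ>\<open>'a \<Rightarrow> real\<close> along \<^const>\<open>dual_apply\<close>.
\<close>

instantiation dual :: (real_tvs) topological_space
begin

definition open_dual :: "'a dual set \<Rightarrow> bool" where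
  "open_dual U \<longleftrightarrow> (\<exists>V. open V \<and> U = dual_apply -` V)"

instance
proof
  show "open (UNIV :: 'a dual set)"
    unfolding open_dual_def by (intro exI[of _ UNIV]) auto
next
  fix S T :: "'a dual set"
  assume "open S" "open T"
  then obtain V W where "open V" "S = dual_apply -` V" "open W" "T = dual_apply -` W"
    unfolding open_dual_def by blast
  then show "open (S \<inter> T)"
    unfolding open_dual_def by (intro exI[of _ "V \<inter> W"]) auto
next
  fix \<K> :: "'a dual set set"
  assume "\<forall>S\<in>\<K>. open S"
  then obtain V where V: "\<And>S. S \<in> \<K> \<Longrightarrow> open (V S) \<and> S = dual_apply -` V S"
    unfolding open_dual_def by metis
  then show "open (\<Union>\<K>)"
    unfolding open_dual_def by (intro exI[of _ "\<Union>(V ` \<K>)"]) blast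
qed

end

definition dom :: "('a \<Rightarrow> ereal) \<Rightarrow> 'a set" where
  "dom h = {x. h x < \<infinity>}"

definition epi :: "('a \<Rightarrow> ereal) \<Rightarrow> ('a \<times> real) set" where
  "epi h = {(x, r). h x \<le> ereal r}"

definition lsc :: "('a::topological_space \<Rightarrow> ereal) \<Rightarrow> bool" where
  "lsc h \<longleftrightarrow> (\<forall>c. open {x. c < h x})"

definition proper :: "('a \<Rightarrow> ereal) \<Rightarrow> bool" where
  "proper h \<longleftrightarrow> (\<forall>x. h x \<noteq> -\<infinity>) \<and> (\<exists>x. h x \<noteq> \<infinity>)"

definition Gamma :: "('a::real_tvs \<Rightarrow> ereal) set" where
  "Gamma = {h. proper h \<and> lsc h \<and> convex (epi h)}"

text \<open>
  On \<^typ>\<open>ereal\<close>, a real number minus \<open>\<infinity>\<close> is \<open>-\<infinity>\<close>; hence the conjugate of the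
  function constantly \<open>\<infinity>\<close> is constantly \<open>-\<infinity>\<close>, and its \<^const>\<open>epi\<close> is the whole space.
\<close>

definition conjugate :: "('a::real_tvs \<Rightarrow> ereal) \<Rightarrow> 'a dual \<Rightarrow> ereal" where
  "conjugate h xs = (SUP x. ereal (dual_apply xs x) - h x)"

definition delta :: "'a set \<Rightarrow> 'a \<Rightarrow> ereal" where
  "delta D x = (if x \<in> D then 0 else \<infinity>)"

definition barr :: "'a::real_tvs set \<Rightarrow> 'a dual set" where
  "barr D = dom (conjugate (delta D))"

text \<open>
  \<^const>\<open>conic\<close> sets are closed under multiplication by all \<open>c \<ge> 0\<close>, so adjoining \<open>0\<close>
  only matters for the empty set.
\<close>

definition gen_cone :: "'a::real_vector set \<Rightarrow> 'a set" where
  "gen_cone D = convex_cone hull (insert 0 D)"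

definition recession_cone :: "'a::real_vector set \<Rightarrow> 'a set" where
  "recession_cone D =
    (let a = (SOME a. a \<in> D) in \<Inter>t\<in>{0<..}. (\<lambda>y. t *\<^sub>R (y - a)) ` D)"

lemma mem_scaled_translate_iff:
  fixes a d :: "'a::real_vector"
  assumes "t > 0"
  shows "d \<in> (\<lambda>y. t *\<^sub>R (y - a)) ` D \<longleftrightarrow> a + (1/t) *\<^sub>R d \<in> D"
proof
  assume "a + (1/t) *\<^sub>R d \<in> D"
  then show "d \<in> (\<lambda>y. t *\<^sub>R (y - a)) ` D"
    using assms by (intro image_eqI[of _ _ "a + (1/t) *\<^sub>R d"]) auto
qed (use assms in auto)

lemma mem_scaled_translates_iff:
  fixes a d :: "'a::real_vector"
  shows "d \<in> (\<Inter>t\<in>{0<..}. (\<lambda>y. t *\<^sub>R (y - a)) ` D) \<longleftrightarrow> (\<forall>s>0. a + s *\<^sub>R d \<in> D)"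
proof -
  have "(\<forall>t>0. a + (1/t) *\<^sub>R d \<in> D) \<longleftrightarrow> (\<forall>s>0. a + s *\<^sub>R d \<in> D)"
    by (metis divide_divide_eq_right div_by_1 mult_1 zero_less_divide_1_iff)
  then show ?thesis
    by (simp only: INT_iff Ball_def greaterThan_iff mem_scaled_translate_iff cong: imp_cong)
qed

text \<open>The chosen base point is immaterial for closed convex sets.\<close>

lemma scaled_translates_subset:
  fixes D :: "'a::real_tvs set"
  assumes D: "closed D" "convex D" and "a \<in> D" "b \<in> D"
  shows "(\<Inter>t\<in>{0<..}. (\<lambda>y. t *\<^sub>R (y - a)) ` D) \<subseteq> (\<Inter>t\<in>{0<..}. (\<lambda>y. t *\<^sub>R (y - b)) ` D)"
proof
  fix d
  assume "d \<in> (\<Inter>t\<in>{0<..}. (\<lambda>y. t *\<^sub>R (y - a)) ` D)"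
  then have a: "\<And>s. s > 0 \<Longrightarrow> a + s *\<^sub>R d \<in> D"
    unfolding mem_scaled_translates_iff by blast
  have "b + s *\<^sub>R d \<in> D" if "s > 0" for s
  proof -
    define u where "u n = inverse (real (Suc n))" for n
    define z where "z n = (1 - u n) *\<^sub>R b + (u n *\<^sub>R a + s *\<^sub>R d)" for n
    have u: "0 < u n" "u n \<le> 1" for n
      unfolding u_def by (auto simp: divide_simps)
    have "z n \<in> D" for n
    proof -
      have "z n = (1 - u n) *\<^sub>R b + u n *\<^sub>R (a + (s / u n) *\<^sub>R d)"
        using u(1)[of n] by (simp add: z_def scaleR_add_right)
      also have "\<dots> \<in> D"
        using u[of n] a[of "s / u n"] \<open>s > 0\<close> \<open>b \<in> D\<close>
        by (intro convexD[OF \<open>convex D\<close>]) auto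
      finally show ?thesis .
    qed
    moreover have "u \<longlonglongrightarrow> 0"
      unfolding u_def by (rule LIMSEQ_inverse_real_of_nat)
    then have "z \<longlonglongrightarrow> (1 - 0) *\<^sub>R b + (0 *\<^sub>R a + s *\<^sub>R d)"
      unfolding z_def by (intro tendsto_add tendsto_scaleR_tvs tendsto_diff tendsto_const)
    ultimately show ?thesis
      using \<open>closed D\<close> by (auto dest: closed_sequentially)
  qed
  then show "d \<in> (\<Inter>t\<in>{0<..}. (\<lambda>y. t *\<^sub>R (y - b)) ` D)"
    unfolding mem_scaled_translates_iff by blast
qed

lemma recession_cone_eq:
  fixes D :: "'a::real_tvs set"
  assumes "closed D" "convex D" "a \<in> D"
  shows "recession_cone D = (\<Inter>t\<in>{0<..}. (\<lambda>y. t *\<^sub>R (y - a)) ` D)"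
  unfolding recession_cone_def Let_def
  by (intro antisym scaled_translates_subset someI[of "\<lambda>a. a \<in> D" a] assms)

definition recession_function :: "('a::real_vector \<Rightarrow> ereal) \<Rightarrow> 'a \<Rightarrow> ereal" where
  "recession_function h = (THE g. epi g = recession_cone (epi h))"

lemma epi_inj: "epi g = epi h \<Longrightarrow> g = h"
proof
  fix x
  assume "epi g = epi h"
  then have "\<And>r. g x \<le> ereal r \<longleftrightarrow> h x \<le> ereal r"
    unfolding epi_def set_eq_iff by auto
  then show "g x = h x"
    by (meson ereal_le_real order_antisym)
qed

text \<open>The definite description always denotes.\<close>

lemma epi_recession_function:
  "epi (recession_function h) = recession_cone (epi h)"
proof -
  define a where "a = (SOME a. a \<in> epi h)"
  define g where "g x = Inf (ereal ` {r. (x, r) \<in> recession_cone (epi h)})" for x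
  have mem: "(x, r) \<in> recession_cone (epi h) \<longleftrightarrow>
      (\<forall>s>0. h (fst a + s *\<^sub>R x) \<le> ereal (snd a + s * r))" for x r
    unfolding recession_cone_def Let_def a_def[symmetric] mem_scaled_translates_iff
    by (cases a) (auto simp: epi_def)
  have "(x, r) \<in> recession_cone (epi h)" if "g x \<le> ereal r" for x r
    unfolding mem
  proof (intro allI impI)
    fix s :: real
    assume "s > 0"
    show "h (fst a + s *\<^sub>R x) \<le> ereal (snd a + s * r)"
    proof (rule ereal_le_epsilon2)
      fix e :: real
      assume "e > 0"
      then have "g x < ereal (r + e / s)"
        using \<open>s > 0\<close> by (intro le_less_trans[OF that]) auto
      then obtain q where q: "(x, q) \<in> recession_cone (epi h)" "q < r + e / s"
        unfolding g_def Inf_less_iff by auto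
      have "h (fst a + s *\<^sub>R x) \<le> ereal (snd a + s * q)"
        using q(1) \<open>s > 0\<close> unfolding mem by blast
      also have "\<dots> \<le> ereal (snd a + s * r) + ereal e"
        using q(2) \<open>s > 0\<close> by (simp add: field_simps)
      finally show "h (fst a + s *\<^sub>R x) \<le> ereal (snd a + s * r) + ereal e" .
    qed
  qed
  moreover have "g x \<le> ereal r" if "(x, r) \<in> recession_cone (epi h)" for x r
    unfolding g_def using that by (intro Inf_lower) auto
  ultimately have "epi g = recession_cone (epi h)"
    unfolding epi_def by auto
  then show ?thesis
    unfolding recession_function_def
    by (rule theI[of "\<lambda>g. epi g = recession_cone (epi h)"]) (simp add: epi_inj \<open>epi g = _\<close>)
qed

text \<open>
  \<open>A\<close>, \<open>K\<close> and \<open>\<Omega>\<close> for the system \<open>x \<in> C\<close>, \<open>fs i x \<le> 0\<close> (\<open>i \<in> I\<close>). The index set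
  \<open>I\<close> may be empty or infinite.
\<close>

definition feasible :: "'a set \<Rightarrow> 'i set \<Rightarrow> ('i \<Rightarrow> 'a \<Rightarrow> ereal) \<Rightarrow> 'a set" where
  "feasible C I fs = {x \<in> C. \<forall>i\<in>I. fs i x \<le> 0}"

definition char_cone ::
    "'a::real_tvs set \<Rightarrow> 'i set \<Rightarrow> ('i \<Rightarrow> 'a \<Rightarrow> ereal) \<Rightarrow> ('a dual \<times> real) set" where
  "char_cone C I fs =
    gen_cone (epi (conjugate (delta C)) \<union> (\<Union>i\<in>I. epi (conjugate (fs i))))"

definition conj_doms :: "'i set \<Rightarrow> ('i \<Rightarrow> 'a::real_tvs \<Rightarrow> ereal) \<Rightarrow> 'a dual set" where
  "conj_doms I fs = (\<Union>i\<in>I. dom (conjugate (fs i)))"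

end

theory Submission
  imports Defs
begin

text \<open>
  Let \<open>E = epi f* + K\<close> and \<open>B = dom f* + cone \<Omega> + barr C\<close>. Since \<open>A\<close> misses the domain of \<open>f\<close>, the
  function \<open>f + delta A\<close> is constantly \<open>\<infinity>\<close> and the epigraph of its conjugate is everything; hence
  (i) and (ii) agree.

  The set \<open>B\<close> is the projection of \<open>E\<close> to the dual space (\<open>fst_epi_plus_char_cone\<close>). The key
  point is that every closed half-space of the product containing \<open>E\<close> is vertical: a nonvertical
  one is given by a point \<open>d\<close> of the original space and, because \<open>h = h**\<close> for \<open>h\<close> in \<open>Gamma\<close>
  (\<open>Fenchel_Moreau_epi\<close>), that point would satisfy all the constraints and lie in the domain of
  \<open>f\<close> (\<open>no_nonvertical_bound\<close>). Consequently the closure of \<open>E\<close> is the full cylinder over the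
  closure of \<open>B\<close>, which is the equivalence of (ii) and (iii).

  For (iii) and (iv), \<open>xs\<close> is separated from \<open>B\<close> by a point \<open>d\<close>. The support function of
  \<open>dom h*\<close> is the recession function of \<open>h\<close> (\<open>recession_function_le_iff_support\<close>), applied to
  \<open>f\<close>, to the \<open>fs i\<close>, and to the indicator of \<open>C\<close>; so the separating points are exactly the
  directions in (iv). Finally, if \<open>A\<close> is nonempty, these constraints on \<open>d\<close> describe the
  recession cone of \<open>A\<close>.

  Both separations, in \<open>X \<times> \<real>\<close> for the biconjugate and in the weak* topology for \<open>E\<close> and \<open>B\<close>, follow
  from one algebraic Hahn--Banach theorem (\<open>separation_by_absorbing_set\<close>), whose functional is
  bounded on a neighbourhood of \<open>0\<close>. On the original space such a functional is continuous; on the weak*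
  dual it is the evaluation at a point (\<open>weak_star_functional_eval\<close>).
\<close>

section \<open>The Hahn--Banach theorem and algebraic separation\<close>

definition sublinear :: "('a::real_vector \<Rightarrow> real) \<Rightarrow> bool" where
  "sublinear p \<longleftrightarrow>
    (\<forall>x y. p (x + y) \<le> p x + p y) \<and> (\<forall>c>0. \<forall>x. p (c *\<^sub>R x) = c * p x)"

lemma sublinear_add: "sublinear p \<Longrightarrow> p (x + y) \<le> p x + p y"
  and sublinear_scaleR: "sublinear p \<Longrightarrow> c > 0 \<Longrightarrow> p (c *\<^sub>R x) = c * p x"
  by (auto simp: sublinear_def)

lemma sublinear_zero: "sublinear p \<Longrightarrow> p 0 = 0"
  using sublinear_scaleR[of p 2 0] by simp

lemma sublinear_scaleR_nonneg: "sublinear p \<Longrightarrow> c \<ge> 0 \<Longrightarrow> p (c *\<^sub>R x) = c * p x"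
  by (cases "c = 0") (auto simp: sublinear_zero sublinear_scaleR)

lemma sublinear_minus: "sublinear p \<Longrightarrow> - p (- x) \<le> p x"
  using sublinear_add[of p x "- x"] sublinear_zero[of p] by simp

text \<open>
  A function is sublinear iff its epigraph is a convex cone. Every sublinear functional below
  (a tilted functional, the infimum of a chain, a gauge) is obtained from a cone \<open>G\<close> by this
  lemma, even when \<open>G\<close> is only the epigraph up to its lower boundary.
\<close>

lemma sublinear_Inf:
  fixes G :: "('a::real_vector \<times> real) set"
  assumes add: "\<And>x y s t. (x, s) \<in> G \<Longrightarrow> (y, t) \<in> G \<Longrightarrow> (x + y, s + t) \<in> G"
    and scale: "\<And>c x s. c > 0 \<Longrightarrow> (x, s) \<in> G \<Longrightarrow> (c *\<^sub>R x, c * s) \<in> G"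
    and ne: "\<And>x. \<exists>s. (x, s) \<in> G"
    and bdd: "\<And>x. bdd_below {s. (x, s) \<in> G}"
  shows "sublinear (\<lambda>x. Inf {s. (x, s) \<in> G})"
proof -
  define p where "p x = Inf {s. (x, s) \<in> G}" for x
  have lower: "p x \<le> s" if "(x, s) \<in> G" for x s
    unfolding p_def using that bdd by (intro cInf_lower) auto
  have greatest: "b \<le> p x" if "\<And>s. (x, s) \<in> G \<Longrightarrow> b \<le> s" for b x
    unfolding p_def using that ne by (intro cInf_greatest) auto
  have "p (x + y) \<le> p x + p y" for x y
  proof -
    have "p (x + y) - s \<le> p y" if "(x, s) \<in> G" for s
    proof (rule greatest)
      show "p (x + y) - s \<le> t" if "(y, t) \<in> G" for t
        using lower[OF add[OF \<open>(x, s) \<in> G\<close> that]] by simp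
    qed
    then have "p (x + y) - p y \<le> p x"
      by (intro greatest) (auto simp: algebra_simps)
    then show ?thesis by simp
  qed
  moreover have le: "p (c *\<^sub>R x) \<le> c * p x" if "c > 0" for c x
  proof -
    have "p (c *\<^sub>R x) / c \<le> p x"
      by (rule greatest) (use lower[OF scale[OF that]] that in \<open>auto simp: field_simps\<close>)
    then show ?thesis using that by (simp add: field_simps)
  qed
  moreover have "c * p x \<le> p (c *\<^sub>R x)" if "c > 0" for c x
    using le[of "1 / c" "c *\<^sub>R x"] that by (simp add: field_simps)
  ultimately have "sublinear p"
    unfolding sublinear_def by (auto intro!: antisym)
  then show ?thesis by (simp add: p_def[abs_def])
qed

text \<open>
  The tilted functional is \<open>q' x = inf {q (x + s *\<^sub>R y) - s * q y | s \<ge> 0}\<close>: the values \<open>s = 0\<close> and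
  \<open>s = 1\<close> give the two bounds. Together they force \<open>q' y = q y\<close> and
  \<open>q' (- y) = - q y\<close>, that is, \<open>q'\<close> is linear along \<open>y\<close>.
\<close>

lemma sublinear_tilt:
  assumes q: "sublinear q"
  obtains q' where "sublinear q'" "\<And>x. q' x \<le> q x" "\<And>x. q' x \<le> q (x + y) - q y"
proof
  define G where "G = {(x, t). \<exists>s\<ge>0. q (x + s *\<^sub>R y) - s * q y \<le> t}"
  have bdd: "bdd_below {s. (x, s) \<in> G}" for x
  proof (rule bdd_belowI)
    fix t assume "t \<in> {s. (x, s) \<in> G}"
    then obtain s where s: "s \<ge> 0" "q (x + s *\<^sub>R y) - s * q y \<le> t" unfolding G_def by auto
    \<comment> \<open>Subadditivity bounds the values below, uniformly in \<open>s\<close>.\<close>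
    have "q (s *\<^sub>R y) \<le> q (x + s *\<^sub>R y) + q (- x)"
      using sublinear_add[OF q, of "x + s *\<^sub>R y" "- x"] by simp
    then show "- q (- x) \<le> t"
      using s by (simp add: sublinear_scaleR_nonneg[OF q])
  qed
  show "sublinear (\<lambda>x. Inf {s. (x, s) \<in> G})"
  proof (rule sublinear_Inf[OF _ _ _ bdd])
    fix x x' t t' assume "(x, t) \<in> G" "(x', t') \<in> G"
    then obtain s s' where s: "s \<ge> 0" "q (x + s *\<^sub>R y) - s * q y \<le> t"
      "s' \<ge> 0" "q (x' + s' *\<^sub>R y) - s' * q y \<le> t'" unfolding G_def by auto
    have "q (x + x' + (s + s') *\<^sub>R y) \<le> q (x + s *\<^sub>R y) + q (x' + s' *\<^sub>R y)"
      using sublinear_add[OF q, of "x + s *\<^sub>R y" "x' + s' *\<^sub>R y"] by (simp add: algebra_simps)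
    then show "(x + x', t + t') \<in> G"
      unfolding G_def using s by (auto intro!: exI[of _ "s + s'"] simp: algebra_simps)
  next
    fix c t :: real and x assume "c > 0" "(x, t) \<in> G"
    then obtain s where s: "s \<ge> 0" "q (x + s *\<^sub>R y) - s * q y \<le> t" unfolding G_def by auto
    have "q (c *\<^sub>R x + (c * s) *\<^sub>R y) = c * q (x + s *\<^sub>R y)"
      using sublinear_scaleR[OF q \<open>c > 0\<close>, of "x + s *\<^sub>R y"] by (simp add: algebra_simps)
    moreover have "c * (q (x + s *\<^sub>R y) - s * q y) \<le> c * t"
      using s \<open>c > 0\<close> by (intro mult_left_mono) auto
    ultimately show "(c *\<^sub>R x, c * t) \<in> G"
      unfolding G_def using s \<open>c > 0\<close> by (auto intro!: exI[of _ "c * s"] simp: algebra_simps)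
  qed (auto simp: G_def intro: exI[of _ 0])
  show "Inf {s. (x, s) \<in> G} \<le> q x" for x
    by (intro cInf_lower bdd) (auto simp: G_def intro!: exI[of _ 0])
  show "Inf {s. (x, s) \<in> G} \<le> q (x + y) - q y" for x
    by (intro cInf_lower bdd) (auto simp: G_def intro!: exI[of _ 1])
qed

text \<open>
  Tilting a minimal functional changes nothing, and the second bound of the tilt is then
  superadditivity.
\<close>

lemma linear_if_minimal_sublinear:
  assumes q: "sublinear q"
    and min: "\<And>q'. sublinear q' \<Longrightarrow> (\<And>x. q' x \<le> q x) \<Longrightarrow> q' = q"
  shows "linear q"
proof -
  have add: "q (x + y) = q x + q y" for x y
  proof -
    obtain q' where q': "sublinear q'" "\<And>x. q' x \<le> q x" "\<And>x. q' x \<le> q (x + y) - q y"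
      using sublinear_tilt[OF q] by blast
    have "q' = q" using min q' by blast
    then show ?thesis using q'(3)[of x] sublinear_add[OF q, of x y] by simp
  qed
  have neg: "q (- x) = - q x" for x
    using add[of x "- x"] sublinear_zero[OF q] by simp
  have "q (c *\<^sub>R x) = c * q x" for c x
  proof (cases "c \<ge> 0")
    case False
    then show ?thesis
      using sublinear_scaleR_nonneg[OF q, of "- c" x] neg[of "c *\<^sub>R x"] by simp
  qed (simp add: sublinear_scaleR_nonneg[OF q])
  with add show ?thesis by (intro linearI) auto
qed

text \<open>
  A minimal sublinear functional below \<open>p\<close> exists by Zorn's lemma and is linear. Working with
  functionals defined on the whole space avoids the extension of partial linear functionals. The
  minimisation starts from the tilt of \<open>p\<close> along \<open>x0\<close>, so that the value at \<open>x0\<close> is prescribed.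
\<close>

theorem Hahn_Banach_sublinear:
  assumes p: "sublinear p"
  obtains L where "linear L" "\<And>x. L x \<le> p x" "L x0 = p x0"
proof -
  obtain p0 where p0: "sublinear p0" "\<And>x. p0 x \<le> p x" "\<And>x. p0 x \<le> p (x + x0) - p x0"
    using sublinear_tilt[OF p] by blast
  define S where "S = {q. sublinear q \<and> q \<le> p0}"
  have "\<exists>m\<in>S. \<forall>q\<in>S. q \<le> m \<longrightarrow> q = m"
  proof (rule predicate_Zorn)
    show "partial_order_on S (relation_of (\<lambda>a b. b \<le> a) S)"
      by (rule partial_order_on_relation_ofI) auto
    fix Q assume Q: "Q \<in> Chains (relation_of (\<lambda>a b. b \<le> a) S)"
    have QS: "Q \<subseteq> S" by (rule Chains_relation_of[OF Q])
    have total: "q \<le> q' \<or> q' \<le> q" if "q \<in> Q" "q' \<in> Q" for q q'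
      using Q that unfolding Chains_def relation_of_def by auto
    show "\<exists>u\<in>S. \<forall>q\<in>Q. u \<le> q"
    proof (cases "Q = {}")
      case True
      then show ?thesis using p0(1) by (auto simp: S_def)
    next
      case False
      define G where "G = {(x, t). \<exists>q\<in>Q. q x \<le> t}"
      have sub: "sublinear q" "q x \<le> p0 x" if "q \<in> Q" for q x
        using that QS by (auto simp: S_def le_fun_def)
      have bdd: "bdd_below {s. (x, s) \<in> G}" for x
      proof (rule bdd_belowI)
        fix t assume "t \<in> {s. (x, s) \<in> G}"
        then obtain q where q: "q \<in> Q" "q x \<le> t" unfolding G_def by auto
        then show "- p0 (- x) \<le> t"
          using sublinear_minus[OF sub(1)[OF q(1)], of x] sub(2)[OF q(1), of "- x"] by linarith
      qed
      have sG: "sublinear (\<lambda>x. Inf {s. (x, s) \<in> G})"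
      proof (rule sublinear_Inf[OF _ _ _ bdd])
        fix x y s t assume "(x, s) \<in> G" "(y, t) \<in> G"
        then obtain q q' where q: "q \<in> Q" "q x \<le> s" "q' \<in> Q" "q' y \<le> t"
          unfolding G_def by auto
        then obtain r where r: "r \<in> Q" "r \<le> q" "r \<le> q'" using total by blast
        have "r (x + y) \<le> s + t"
          using sublinear_add[OF sub(1)[OF r(1)], of x y] le_funD[OF r(2), of x]
            le_funD[OF r(3), of y] q by linarith
        then show "(x + y, s + t) \<in> G" using r(1) by (auto simp: G_def)
      next
        fix c s :: real and x assume "c > 0" "(x, s) \<in> G"
        then show "(c *\<^sub>R x, c * s) \<in> G"
          by (auto simp: G_def sublinear_scaleR[OF sub(1)] intro!: bexI)
      qed (use False in \<open>auto simp: G_def\<close>)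
      have lower: "Inf {s. (x, s) \<in> G} \<le> q x" if "q \<in> Q" for q x
        using that by (intro cInf_lower bdd) (auto simp: G_def)
      have "(\<lambda>x. Inf {s. (x, s) \<in> G}) \<le> p0"
      proof -
        from False obtain q where "q \<in> Q" by blast
        then have "Inf {s. (x, s) \<in> G} \<le> p0 x" for x
          using lower[of q x] sub(2)[of q x] by linarith
        then show ?thesis by (simp add: le_fun_def)
      qed
      then show ?thesis
        using sG lower by (intro bexI[of _ "\<lambda>x. Inf {s. (x, s) \<in> G}"])
          (auto simp: S_def le_fun_def)
    qed
  qed
  then obtain m where m: "m \<in> S" and min: "\<And>q. q \<in> S \<Longrightarrow> q \<le> m \<Longrightarrow> q = m" by blast
  have lin: "linear m"
  proof (rule linear_if_minimal_sublinear)
    show "sublinear m" using m by (simp add: S_def)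
    show "q = m" if "sublinear q" "\<And>x. q x \<le> m x" for q
      using that m by (intro min) (auto simp: S_def le_fun_def intro: order_trans)
  qed
  have le: "m x \<le> p x" for x
    using m p0(2)[of x] by (auto simp: S_def le_fun_def intro: order_trans)
  have "m (- x0) \<le> - p x0"
    using m p0(3)[of "- x0"] sublinear_zero[OF p]
    by (auto simp: S_def le_fun_def intro: order_trans)
  then have "m x0 = p x0"
    using le[of x0] linear_neg[OF lin, of x0] by simp
  then show thesis using that lin le by blast
qed

text \<open>
  The Minkowski functional of a convex absorbing set. Scaling towards the origin does not leave the
  set, so a point outside the set cannot have value below \<open>1\<close>.
\<close>

lemma sublinear_gauge:
  fixes D :: "'a::real_vector set"
  assumes D: "convex D" "0 \<in> D" and abs: "\<And>x. \<exists>t>0. t *\<^sub>R x \<in> D"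
  defines "p \<equiv> \<lambda>x. Inf {t. t > 0 \<and> (1 / t) *\<^sub>R x \<in> D}"
  shows "sublinear p" and "\<And>x. x \<in> D \<Longrightarrow> p x \<le> 1" and "\<And>x. x \<notin> D \<Longrightarrow> 1 \<le> p x"
proof -
  define G where "G = {(x, t). t > 0 \<and> (1 / t) *\<^sub>R x \<in> D}"
  have p: "p = (\<lambda>x. Inf {t. (x, t) \<in> G})" by (simp add: p_def G_def)
  have bdd: "bdd_below {s. (x, s) \<in> G}" for x
    by (rule bdd_belowI[of _ 0]) (auto simp: G_def)
  have ne: "\<exists>s. (x, s) \<in> G" for x
  proof -
    obtain t where "t > 0" "t *\<^sub>R x \<in> D" using abs by blast
    then show ?thesis by (auto simp: G_def intro!: exI[of _ "1 / t"])
  qed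
  show "sublinear p"
    unfolding p
  proof (rule sublinear_Inf[OF _ _ ne bdd])
    fix x y s t assume "(x, s) \<in> G" "(y, t) \<in> G"
    then have *: "s > 0" "t > 0" "(1 / s) *\<^sub>R x \<in> D" "(1 / t) *\<^sub>R y \<in> D" by (auto simp: G_def)
    have "(s / (s + t)) *\<^sub>R (1 / s) *\<^sub>R x + (t / (s + t)) *\<^sub>R (1 / t) *\<^sub>R y \<in> D"
      using * by (intro convexD[OF D(1)]) (auto simp flip: add_divide_distrib)
    then show "(x + y, s + t) \<in> G"
      using * by (simp add: G_def scaleR_add_right)
  qed (auto simp: G_def)
  show "p x \<le> 1" if "x \<in> D" for x
    unfolding p using that by (intro cInf_lower bdd) (auto simp: G_def)
  show "1 \<le> p x" if "x \<notin> D" for x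
    unfolding p
  proof (rule cInf_greatest)
    fix t assume "t \<in> {t. (x, t) \<in> G}"
    then have t: "t > 0" "(1 / t) *\<^sub>R x \<in> D" by (auto simp: G_def)
    show "1 \<le> t"
    proof (rule ccontr)
      assume "\<not> 1 \<le> t"
      then have "t *\<^sub>R (1 / t) *\<^sub>R x + (1 - t) *\<^sub>R 0 \<in> D"
        using t D(2) by (intro convexD[OF D(1)]) auto
      then show False using t(1) that by simp
    qed
  qed (use ne in auto)
qed

text \<open>
  Separation in the absence of a topology: \<open>V\<close> plays the role of a convex neighbourhood of \<open>0\<close> that fits
  between \<open>x\<close> and \<open>S\<close>. The set \<open>D = S - s0 + V\<close> is convex, absorbing, and misses \<open>x - s0\<close>, so a
  linear functional dominated by its gauge and agreeing with it at \<open>x - s0\<close> separates; the summand \<open>V\<close>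
  makes the separation strict. The bound on \<open>V\<close> encodes continuity and is exploited differently
  on the original space and on its dual.
\<close>

theorem separation_by_absorbing_set:
  fixes S V :: "'v::real_vector set"
  assumes S: "convex S" and V: "convex V" "0 \<in> V" "\<And>y. \<exists>t>0. t *\<^sub>R y \<in> V"
    and disj: "\<And>v. v \<in> V \<Longrightarrow> x - v \<notin> S"
  obtains L b c where "linear L" "\<forall>v\<in>V. L v \<le> b" "\<forall>y\<in>S. L y \<le> c" "c < (L x :: real)"
proof (cases "S = {}")
  case True
  show thesis by (rule that[of "\<lambda>_. 0" 0 "-1"]) (auto simp: True linear_iff)
next
  case False
  then obtain s0 where s0: "s0 \<in> S" by blast
  define D where "D = {s - s0 + v |s v. s \<in> S \<and> v \<in> V}"
  have D: "convex D"
    unfolding convex_def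
  proof (intro ballI allI impI)
    fix a b :: 'v and \<mu> \<nu> :: real
    assume "a \<in> D" "b \<in> D" and \<mu>: "0 \<le> \<mu>" "0 \<le> \<nu>" "\<mu> + \<nu> = 1"
    then obtain s v s' v' where *: "a = s - s0 + v" "b = s' - s0 + v'" "s \<in> S" "s' \<in> S" "v \<in> V" "v' \<in> V"
      unfolding D_def by blast
    have "\<mu> *\<^sub>R s + \<nu> *\<^sub>R s' \<in> S" "\<mu> *\<^sub>R v + \<nu> *\<^sub>R v' \<in> V"
      using * \<mu> S V(1) by (auto intro: convexD)
    moreover have "\<mu> *\<^sub>R a + \<nu> *\<^sub>R b
        = (\<mu> *\<^sub>R s + \<nu> *\<^sub>R s') - (\<mu> + \<nu>) *\<^sub>R s0 + (\<mu> *\<^sub>R v + \<nu> *\<^sub>R v')"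
      by (simp add: * algebra_simps)
    ultimately show "\<mu> *\<^sub>R a + \<nu> *\<^sub>R b \<in> D" unfolding D_def \<mu>(3) by auto
  qed
  have VD: "V \<subseteq> D" unfolding D_def using s0 by force
  have xD: "x - s0 \<notin> D"
  proof
    assume "x - s0 \<in> D"
    then obtain s v where "s \<in> S" "v \<in> V" "x - s0 = s - s0 + v" unfolding D_def by blast
    moreover from this have "x - v = s" by (simp add: algebra_simps)
    ultimately show False using disj[of v] by simp
  qed
  have abs: "\<exists>t>0. t *\<^sub>R y \<in> D" for y using V(3)[of y] VD by (meson subsetD)
  note gauge = sublinear_gauge[OF D subsetD[OF VD V(2)] abs]
  obtain L where L: "linear L" and le: "\<And>y. L y \<le> Inf {t. t > 0 \<and> (1 / t) *\<^sub>R y \<in> D}"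
    and eq: "L (x - s0) = Inf {t. t > 0 \<and> (1 / t) *\<^sub>R (x - s0) \<in> D}"
    using Hahn_Banach_sublinear[OF gauge(1)] by blast
  have LD: "L y \<le> 1" if "y \<in> D" for y using le[of y] gauge(2)[OF that] by linarith
  have Lx: "1 \<le> L (x - s0)" using eq gauge(3)[OF xD] by simp
  obtain t where t: "t > 0" "t *\<^sub>R (x - s0) \<in> V" using V(3) by blast
  have "L y \<le> L x - t * L (x - s0)" if "y \<in> S" for y
  proof -
    \<comment> \<open>A small multiple of \<open>x - s0\<close> lies in \<open>V\<close>; adding it to \<open>y - s0\<close> gains the strict margin.\<close>
    have "y - s0 + t *\<^sub>R (x - s0) \<in> D" using that t by (auto simp: D_def)
    from LD[OF this] have "L y - L s0 + t * L (x - s0) \<le> 1"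
      by (simp add: linear_add[OF L] linear_diff[OF L] linear_cmul[OF L])
    with Lx show ?thesis by (simp add: linear_diff[OF L])
  qed
  then have "\<forall>y\<in>S. L y \<le> L x - t * L (x - s0)" by blast
  moreover have "\<forall>v\<in>V. L v \<le> 1" using LD VD by blast
  moreover have "L x - t * L (x - s0) < L x" using t Lx by simp
  ultimately show thesis by (intro that[OF L])
qed

section \<open>Separation in locally convex spaces\<close>

lemma nonpos_if_multiples_bounded:
  fixes g M :: real
  assumes "\<And>s. s > 0 \<Longrightarrow> s * g \<le> M"
  shows "g \<le> 0"
proof (rule ccontr)
  assume "\<not> g \<le> 0"
  moreover have "(\<bar>M\<bar> + 1) / g * g \<le> M"
    using \<open>\<not> g \<le> 0\<close> by (intro assms divide_pos_pos) auto
  ultimately show False by simp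
qed

lemma open_reflection:
  fixes U :: "'a::topological_ab_group_add set"
  assumes "open U"
  shows "open {x. a - x \<in> U}"
proof -
  have "continuous_on UNIV (\<lambda>x. a - x)"
    unfolding continuous_on_def by (intro ballI tendsto_diff tendsto_const tendsto_ident_at)
  from open_vimage[OF assms this] show ?thesis by (simp add: vimage_def)
qed

lemma absorbing_nhd:
  fixes U :: "'a::real_tvs set"
  assumes "open U" "0 \<in> U"
  shows "\<exists>t>0. t *\<^sub>R x \<in> U"
proof -
  have "((\<lambda>t. t *\<^sub>R x) \<longlongrightarrow> 0 *\<^sub>R x) (at_right 0)"
    by (intro tendsto_scaleR_tvs tendsto_intros)
  then have "\<forall>\<^sub>F t in at_right 0. t *\<^sub>R x \<in> U"
    using assms by (auto intro!: topological_tendstoD)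
  moreover have "\<forall>\<^sub>F t in at_right (0::real). t > 0"
    by (simp add: eventually_at_right_less)
  ultimately have "\<forall>\<^sub>F t in at_right 0. t > 0 \<and> t *\<^sub>R x \<in> U"
    by eventually_elim auto
  then show ?thesis
    by (rule eventually_happens'[OF trivial_limit_at_right_real])
qed

text \<open>
  A bound from above suffices: applied to large multiples of \<open>y - x\<close> and of \<open>x - y\<close>, it bounds
  \<open>L y - L x\<close> on both sides.
\<close>

lemma continuous_linear_if_bounded_nhd:
  fixes L :: "'a::real_tvs \<Rightarrow> real"
  assumes L: "linear L" and U: "open U" "0 \<in> U" and bdd: "\<And>u. u \<in> U \<Longrightarrow> L u \<le> b"
  shows "continuous_on UNIV L"
proof -
  have "(L \<longlongrightarrow> L x) (nhds x)" for x
  proof (rule tendstoI)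
    fix e :: real assume "e > 0"
    define c where "c = e / (\<bar>b\<bar> + 1)"
    have c: "c > 0" using \<open>e > 0\<close> by (simp add: c_def)
    have "c * \<bar>b\<bar> < e" using \<open>e > 0\<close> by (simp add: c_def field_simps)
    moreover have "c * b \<le> c * \<bar>b\<bar>" using c by (intro mult_left_mono) auto
    ultimately have cb: "c * b < e" by linarith
    have "((\<lambda>y. (1 / c) *\<^sub>R (y - x)) \<longlongrightarrow> (1 / c) *\<^sub>R (x - x)) (nhds x)"
      "((\<lambda>y. (1 / c) *\<^sub>R (x - y)) \<longlongrightarrow> (1 / c) *\<^sub>R (x - x)) (nhds x)"
      by (intro tendsto_scaleR_tvs tendsto_intros tendsto_ident_at filterlim_ident)+
    then have "\<forall>\<^sub>F y in nhds x. (1 / c) *\<^sub>R (y - x) \<in> U" "\<forall>\<^sub>F y in nhds x. (1 / c) *\<^sub>R (x - y) \<in> U"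
      using U by (auto intro!: topological_tendstoD)
    then show "\<forall>\<^sub>F y in nhds x. dist (L y) (L x) < e"
    proof eventually_elim
      case (elim y)
      have "(1 / c) * (L y - L x) \<le> b" "(1 / c) * (L x - L y) \<le> b"
        using bdd[OF elim(1)] bdd[OF elim(2)] by (simp_all add: linear_cmul[OF L] linear_diff[OF L])
      then have "L y - L x \<le> c * b" "L x - L y \<le> c * b"
        using c by (simp_all add: field_simps)
      then show ?case using cb by (simp add: dist_real_def abs_if)
    qed
  qed
  then show ?thesis
    unfolding continuous_on_def by (simp add: tendsto_at_iff_tendsto_nhds)
qed

lemma linear_dual_apply: "linear (dual_apply u)"
  using dual_apply[of u] by auto

lemma convex_nhd_of_0:
  fixes U :: "'a::locally_convex_t2 set"
  assumes "open U" "0 \<in> U"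
  obtains V where "open V" "convex V" "0 \<in> V" "V \<subseteq> U"
  using convex_nhds_0[OF assms] by (auto simp flip: convex_def)

lemma convex_shrink:
  assumes U: "convex U" "0 \<in> U" "t *\<^sub>R z \<in> U" and s: "0 < s" "s \<le> t"
  shows "s *\<^sub>R z \<in> U"
proof -
  have "(s / t) *\<^sub>R t *\<^sub>R z + (1 - s / t) *\<^sub>R 0 \<in> U"
    using U s by (intro convexD[OF U(1)]) auto
  then show ?thesis using s by simp
qed

lemma absorbing_Times:
  fixes V :: "'v::real_vector set" and W :: "'w::real_vector set"
  assumes V: "convex V" "0 \<in> V" "\<exists>t>0. t *\<^sub>R x \<in> V"
    and W: "convex W" "0 \<in> W" "\<exists>t>0. t *\<^sub>R y \<in> W"
  shows "\<exists>t>0. t *\<^sub>R (x, y) \<in> V \<times> W"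
proof -
  obtain t s where t: "t > 0" "t *\<^sub>R x \<in> V" and s: "s > 0" "s *\<^sub>R y \<in> W" using V(3) W(3) by blast
  show ?thesis
    using convex_shrink[OF V(1,2) t(2), of "min t s"] convex_shrink[OF W(1,2) s(2), of "min t s"] t(1) s(1)
    by (intro exI[of _ "min t s"]) auto
qed

lemma linear_prod_split:
  fixes L :: "'v::real_vector \<times> real \<Rightarrow> real"
  assumes L: "linear L"
  shows "linear (\<lambda>x. L (x, 0))" and "L (x, s) = L (x, 0) + L (0, 1) * s"
proof -
  show "linear (\<lambda>x. L (x, 0))"
    using linear_add[OF L, of "(_, 0)" "(_, 0)"] linear_cmul[OF L, of _ "(_, 0)"]
    by (intro linearI) simp_all
  have "(x, s) = (x, 0) + s *\<^sub>R (0, 1)" by simp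
  then show "L (x, s) = L (x, 0) + L (0, 1) * s"
    by (simp only: linear_add[OF L] linear_cmul[OF L]) simp
qed

text \<open>
  The neighbourhoods of the first factor enter only through the convex absorbing set \<open>V\<close>, so that the same
  argument serves the original space and its dual.
\<close>

lemma product_separation_by_absorbing_set:
  fixes S :: "('v::real_vector \<times> real) set"
  assumes S: "convex S" and V: "convex V" "0 \<in> V" "\<And>y. \<exists>t>0. t *\<^sub>R y \<in> V"
    and B: "open B" "r \<in> B" and disj: "\<And>v q. v \<in> V \<Longrightarrow> q \<in> B \<Longrightarrow> (x - v, q) \<notin> S"
  obtains l b \<beta> c where "linear l" "\<forall>v\<in>V. l v \<le> \<beta>"
    "\<forall>(y, s)\<in>S. l y + b * s \<le> c" "c < (l x :: real) + b * r"
proof -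
  have "open {s. r - s \<in> B}" "0 \<in> {s. r - s \<in> B}" using B by (auto intro: open_reflection)
  then obtain W where W: "open W" "convex W" "0 \<in> W" "W \<subseteq> {s. r - s \<in> B}"
    by (rule convex_nhd_of_0)
  have abs: "\<exists>t>0. t *\<^sub>R y \<in> W" for y by (rule absorbing_nhd[OF W(1,3)])
  have zero: "0 \<in> V \<times> W" using V(2) W(3) by (simp add: mem_Times_iff)
  have absVW: "\<exists>t>0. t *\<^sub>R p \<in> V \<times> W" for p
    using absorbing_Times[OF V(1,2) V(3) W(2,3) abs, of "fst p" "snd p"] by simp
  have disjVW: "(x, r) - p \<notin> S" if "p \<in> V \<times> W" for p
    using that W(4) disj[of "fst p" "r - snd p"] by (cases p) auto
  obtain L \<beta> c where L: "linear L" and bdd: "\<forall>p\<in>V \<times> W. L p \<le> \<beta>"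
    and sep: "\<forall>p\<in>S. L p \<le> c" "c < (L (x, r) :: real)"
    by (rule separation_by_absorbing_set[OF S convex_Times[OF V(1) W(2)] zero absVW disjVW])
  note split = linear_prod_split[OF L]
  show thesis
  proof (rule that[OF split(1)])
    show "\<forall>v\<in>V. L (v, 0) \<le> \<beta>" using bdd W(3) by auto
    show "\<forall>(y, s)\<in>S. L (y, 0) + L (0, 1) * s \<le> c"
      using sep(1) by (auto simp flip: split(2))
    show "c < L (x, 0) + L (0, 1) * r" using sep(2) by (simp flip: split(2))
  qed
qed

corollary product_separation:
  fixes S :: "('a::locally_convex_t2 \<times> real) set"
  assumes S: "convex S" and x: "(x, r) \<notin> closure S"
  obtains u b c where "\<forall>(y, s)\<in>S. dual_apply u y + b * s \<le> c"
    "c < dual_apply u x + b * r"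
proof -
  have "open (- closure S)" "(x, r) \<in> - closure S" using x by auto
  then obtain A B where AB: "open A" "open B" "(x, r) \<in> A \<times> B" "A \<times> B \<subseteq> - closure S"
    by (rule open_prod_elim)
  then have "open {v. x - v \<in> A}" "0 \<in> {v. x - v \<in> A}" by (auto intro: open_reflection)
  then obtain V where V: "open V" "convex V" "0 \<in> V" "V \<subseteq> {v. x - v \<in> A}"
    by (rule convex_nhd_of_0)
  have abs: "\<exists>t>0. t *\<^sub>R y \<in> V" for y by (rule absorbing_nhd[OF V(1,3)])
  have r: "r \<in> B" using AB(3) by simp
  have disj: "(x - v, q) \<notin> S" if "v \<in> V" "q \<in> B" for v q
  proof -
    have "(x - v, q) \<notin> closure S" using that V(4) AB(4) by blast
    then show ?thesis using closure_subset[of S] by blast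
  qed
  obtain l b \<beta> c where l: "linear l" "\<forall>v\<in>V. l v \<le> \<beta>"
    "\<forall>(y, s)\<in>S. l y + b * s \<le> c" "c < l x + b * r"
    by (rule product_separation_by_absorbing_set[OF S V(2,3) abs AB(2) r disj])
  have "continuous_on UNIV l"
    by (rule continuous_linear_if_bounded_nhd[OF l(1) V(1,3)]) (use l(2) in blast)
  then have "dual_apply (Abs_dual l) = l" using l(1) by (simp add: Abs_dual_inverse)
  with l(3,4) show thesis by (intro that[of "Abs_dual l" b c]) auto
qed

section \<open>Separation in the weak* topology\<close>

lemma dual_apply_simps [simp]:
  "dual_apply 0 x = 0" "dual_apply (u + v) x = dual_apply u x + dual_apply v x"
  "dual_apply (- u) x = - dual_apply u x" "dual_apply (u - v) x = dual_apply u x - dual_apply v x"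
  "dual_apply (c *\<^sub>R u) x = c * dual_apply u x"
  by (transfer, simp)+

lemma dual_apply_linear [simp]:
  "dual_apply u 0 = 0" "dual_apply u (x + y) = dual_apply u x + dual_apply u y"
  "dual_apply u (- x) = - dual_apply u x" "dual_apply u (x - y) = dual_apply u x - dual_apply u y"
  "dual_apply u (c *\<^sub>R x) = c * dual_apply u x"
  using linear_dual_apply[of u]
  by (simp_all add: linear_0 linear_add linear_neg linear_diff linear_cmul)

lemma continuous_on_dual_eval: "continuous_on UNIV (\<lambda>u::'a::real_tvs dual. dual_apply u x)"
proof -
  have "open (dual_apply -` W)" if "open W" for W :: "('a \<Rightarrow> real) set"
    unfolding open_dual_def using that by blast
  then have "continuous_on UNIV (dual_apply :: 'a dual \<Rightarrow> 'a \<Rightarrow> real)"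
    by (simp add: continuous_on_open_vimage)
  then show ?thesis by (rule continuous_on_product_then_coordinatewise)
qed

text \<open>
  Only finitely many points are tested by a basic weak* neighbourhood; this is what makes every
  weak*-continuous functional an evaluation.
\<close>

lemma dual_nhd_basis:
  fixes U :: "'a::real_tvs dual set"
  assumes "open U" "u \<in> U"
  obtains F e where "finite F" "e > 0"
    "{v. \<forall>x\<in>F. \<bar>dual_apply v x - dual_apply u x\<bar> < e} \<subseteq> U"
proof -
  obtain W where W: "open W" "U = dual_apply -` W"
    using assms(1) unfolding open_dual_def by blast
  then have "openin (product_topology (\<lambda>_. euclidean) UNIV) W" "dual_apply u \<in> W"
    using assms(2) by (auto simp: open_fun_def)
  from product_topology_open_contains_basis[OF this] obtain X where X: "dual_apply u \<in> (\<Pi>\<^sub>E i\<in>UNIV. X i)" "\<And>i. open (X i)"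
    "finite {i. X i \<noteq> UNIV}" "(\<Pi>\<^sub>E i\<in>UNIV. X i) \<subseteq> W"
    by auto
  define F where "F = {i. X i \<noteq> UNIV}"
  have "\<exists>e>0. \<forall>t. \<bar>t - dual_apply u x\<bar> < e \<longrightarrow> t \<in> X x" for x
    using X(1) X(2)[of x] unfolding open_dist PiE_iff by (auto simp: dist_real_def)
  then obtain e where e: "\<And>x. e x > 0" "\<And>x t. \<bar>t - dual_apply u x\<bar> < e x \<Longrightarrow> t \<in> X x"
    by metis
  define d where "d = Min (insert 1 (e ` F))"
  have F: "finite F" using X(3) by (simp add: F_def)
  have d: "d > 0" "\<And>x. x \<in> F \<Longrightarrow> d \<le> e x"
    using F e(1) by (auto simp: d_def)
  show thesis
  proof (rule that[OF F d(1)], rule subsetI)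
    fix v assume v: "v \<in> {v. \<forall>x\<in>F. \<bar>dual_apply v x - dual_apply u x\<bar> < d}"
    have "dual_apply v x \<in> X x" for x
    proof (cases "x \<in> F")
      case True
      then show ?thesis using v d(2) by (intro e(2)) force
    qed (simp add: F_def)
    then show "v \<in> U" using X(4) W(2) by auto
  qed
qed

text \<open>
  A linear functional vanishing on the common kernel of finitely many others is a linear
  combination of them. In the induction, a vector \<open>w\<close> in the kernel of the old functionals but
  not of the new one determines the coefficient of the new one.
\<close>

lemma linear_functional_combination:
  fixes L :: "'v::real_vector \<Rightarrow> real" and g :: "'k \<Rightarrow> 'v \<Rightarrow> real"
  assumes "finite F" "linear L" "\<And>k. k \<in> F \<Longrightarrow> linear (g k)"
    and "\<And>v. (\<And>k. k \<in> F \<Longrightarrow> g k v = 0) \<Longrightarrow> L v = 0"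
  obtains c where "\<And>v. L v = (\<Sum>k\<in>F. c k * g k v)"
proof -
  have "\<exists>c. \<forall>v. L v = (\<Sum>k\<in>F. c k * g k v)"
    using assms
  proof (induction F arbitrary: L)
    case empty
    then show ?case by simp
  next
    case (insert j F)
    show ?case
    proof (cases "\<exists>w. (\<forall>k\<in>F. g k w = 0) \<and> g j w \<noteq> 0")
      case False
      then obtain c where c: "\<And>v. L v = (\<Sum>k\<in>F. c k * g k v)"
        using insert.IH[of L] insert.prems by blast
      show ?thesis
        using insert.hyps c by (intro exI[of _ "c(j := 0)"]) (auto intro!: sum.cong)
    next
      case True
      then obtain w where w: "\<And>k. k \<in> F \<Longrightarrow> g k w = 0" "g j w \<noteq> 0" by blast
      have lin: "linear (g k)" if "k \<in> insert j F" for k using insert.prems(2) that by blast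
      define a where "a = L w / g j w"
      \<comment> \<open>Subtracting the \<open>g j\<close> component leaves a functional that vanishes on the kernel of \<open>F\<close> alone.\<close>
      have "\<exists>c. \<forall>v. L v - a * g j v = (\<Sum>k\<in>F. c k * g k v)"
      proof (rule insert.IH)
        show "linear (\<lambda>v. L v - a * g j v)"
          using insert.prems(1) lin[of j]
          by (auto intro!: linearI simp: linear_add linear_cmul algebra_simps)
        show "linear (g k)" if "k \<in> F" for k using lin that by blast
        fix v assume v: "\<And>k. k \<in> F \<Longrightarrow> g k v = 0"
        have "L (v - (g j v / g j w) *\<^sub>R w) = 0"
          using v w by (intro insert.prems(3)) (auto simp: linear_diff[OF lin] linear_cmul[OF lin])
        then show "L v - a * g j v = 0"
          using insert.prems(1) by (simp add: a_def linear_diff linear_cmul)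
      qed
      then obtain c where c: "\<And>v. L v - a * g j v = (\<Sum>k\<in>F. c k * g k v)" by blast
      have "L v = (\<Sum>k\<in>insert j F. (c(j := a)) k * g k v)" for v
      proof -
        have "(\<Sum>k\<in>F. (c(j := a)) k * g k v) = (\<Sum>k\<in>F. c k * g k v)"
          using insert.hyps by (intro sum.cong) auto
        then show ?thesis using insert.hyps c[of v] by simp
      qed
      then show ?thesis by blast
    qed
  qed
  then show thesis using that by blast
qed

lemma weak_star_slab:
  fixes F :: "'a::real_tvs set"
  assumes F: "finite F" "e > 0"
  defines "V \<equiv> {v. \<forall>x\<in>F. \<bar>dual_apply v x\<bar> < e}"
  shows "convex V" "0 \<in> V" "\<And>v. \<exists>t>0. t *\<^sub>R v \<in> V"
proof -
  have "V = (\<Inter>x\<in>F. (\<lambda>v. dual_apply v x) -` {-e<..<e})" by (auto simp: V_def abs_less_iff)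
  moreover have "convex ((\<lambda>v::'a dual. dual_apply v x) -` {-e<..<e})" for x
    by (intro convex_linear_vimage convex_real_interval) (auto intro!: linearI)
  ultimately show "convex V" by (simp add: convex_INT)
  show "0 \<in> V" using F(2) by (simp add: V_def)
  fix v :: "'a dual"
  define m where "m = (\<Sum>x\<in>F. \<bar>dual_apply v x\<bar>) + 1"
  have m: "m > 0" by (simp add: m_def add_nonneg_pos sum_nonneg)
  have "(e / m) *\<^sub>R v \<in> V"
  proof -
    have "e / m * \<bar>dual_apply v x\<bar> < e" if "x \<in> F" for x
    proof -
      have "\<bar>dual_apply v x\<bar> \<le> (\<Sum>x\<in>F. \<bar>dual_apply v x\<bar>)" using F(1) that by (intro member_le_sum) auto
      then have "e * \<bar>dual_apply v x\<bar> < e * m" using F(2) by (simp add: m_def)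
      then show ?thesis using m by (simp add: field_simps)
    qed
    then show ?thesis using F(2) m by (simp add: V_def abs_mult)
  qed
  then show "\<exists>t>0. t *\<^sub>R v \<in> V" using F(2) m by (intro exI[of _ "e / m"]) auto
qed

text \<open>
  The dual of the weak* dual is the space itself. A functional bounded on a basic
  neighbourhood is bounded, hence zero, on the functionals annihilating the finitely many points of \<open>F\<close>;
  it is then a combination of the evaluations at these points.
\<close>

theorem weak_star_functional_eval:
  fixes l :: "'a::real_tvs dual \<Rightarrow> real"
  assumes F: "finite F" "e > 0" and l: "linear l"
    and bdd: "\<forall>v\<in>{v. \<forall>x\<in>F. \<bar>dual_apply v x\<bar> < e}. l v \<le> \<beta>"
  obtains d where "\<forall>u. l u = dual_apply u d"
proof -
  have le: "l v \<le> 0" if "\<And>x. x \<in> F \<Longrightarrow> dual_apply v x = 0" for v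
  proof (rule nonpos_if_multiples_bounded)
    fix s :: real
    have "l (s *\<^sub>R v) \<le> \<beta>" using that F(2) by (intro bspec[OF bdd]) simp
    then show "s * l v \<le> \<beta>" by (simp add: linear_cmul[OF l])
  qed
  have ker: "l v = 0" if "\<And>x. x \<in> F \<Longrightarrow> dual_apply v x = 0" for v
    using le[of v] le[of "- v"] that by (simp add: linear_neg[OF l])
  obtain c where c: "\<And>v. l v = (\<Sum>x\<in>F. c x * dual_apply v x)"
    by (rule linear_functional_combination[OF F(1) l, where g = "\<lambda>x v. dual_apply v x"])
      (auto intro!: linearI ker)
  have "l u = dual_apply u (\<Sum>x\<in>F. c x *\<^sub>R x)" for u
    unfolding c by (simp add: linear_sum[OF linear_dual_apply])
  then show thesis using that by blast
qed

corollary weak_star_product_separation: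
  fixes E :: "('a::real_tvs dual \<times> real) set"
  assumes E: "convex E" and v: "(v, r) \<notin> closure E"
  obtains d b c where "\<forall>(u, s)\<in>E. dual_apply u d + b * s \<le> c"
    "c < dual_apply v d + b * r"
proof -
  have "open (- closure E)" "(v, r) \<in> - closure E" using v by auto
  then obtain A B where AB: "open A" "open B" "(v, r) \<in> A \<times> B" "A \<times> B \<subseteq> - closure E"
    by (rule open_prod_elim)
  have vr: "v \<in> A" "r \<in> B" using AB(3) by auto
  obtain F e where F: "finite F" "e > 0" and
    FA: "{w. \<forall>x\<in>F. \<bar>dual_apply w x - dual_apply v x\<bar> < e} \<subseteq> A"
    by (rule dual_nhd_basis[OF AB(1) vr(1)])
  define V where "V = {w :: 'a dual. \<forall>x\<in>F. \<bar>dual_apply w x\<bar> < e}"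
  note V = weak_star_slab[OF F, folded V_def]
  have disj: "(v - w, q) \<notin> E" if "w \<in> V" "q \<in> B" for w q
  proof -
    have "v - w \<in> A" using that(1) by (intro subsetD[OF FA]) (simp add: V_def)
    then have "(v - w, q) \<notin> closure E" using that(2) AB(4) by blast
    then show ?thesis using closure_subset[of E] by blast
  qed
  obtain l b \<beta> c where l: "linear l" "\<forall>w\<in>V. l w \<le> \<beta>"
    "\<forall>(u, s)\<in>E. l u + b * s \<le> c" "c < l v + b * r"
    by (rule product_separation_by_absorbing_set[OF E V AB(2) vr(2) disj])
  obtain d where "\<forall>u. l u = dual_apply u d"
    by (rule weak_star_functional_eval[OF F l(1) l(2)[unfolded V_def]])
  with l(3,4) show thesis by (intro that[of d b c]) auto
qed

text \<open>
  Separation in the weak* topology is performed by points of the original space. The product version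
  is applied to the cylinder over \<open>B\<close>.
\<close>

corollary not_in_weak_star_closure_iff:
  fixes B :: "'a::real_tvs dual set"
  assumes B: "convex B"
  shows "v \<notin> closure B \<longleftrightarrow> (\<exists>d c. (\<forall>u\<in>B. dual_apply u d \<le> c) \<and> c < dual_apply v d)"
proof
  assume "v \<notin> closure B"
  then have "(v, 0) \<notin> closure (B \<times> (UNIV :: real set))" by (simp add: closure_Times)
  then obtain d b c where sep: "\<forall>(u, s)\<in>B \<times> UNIV. dual_apply u d + b * s \<le> c"
    "c < dual_apply v d + b * 0"
    by (rule weak_star_product_separation[OF convex_Times[OF B convex_UNIV]])
  then have "\<forall>u\<in>B. dual_apply u d + b * 0 \<le> c" by blast
  with sep(2) show "\<exists>d c. (\<forall>u\<in>B. dual_apply u d \<le> c) \<and> c < dual_apply v d" by auto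
next
  assume "\<exists>d c. (\<forall>u\<in>B. dual_apply u d \<le> c) \<and> c < dual_apply v d"
  then obtain d c where d: "\<forall>u\<in>B. dual_apply u d \<le> c" "c < dual_apply v d" by blast
  have "closed ((\<lambda>u. dual_apply u d) -` {..c})"
    by (intro closed_vimage continuous_on_dual_eval) simp
  then have "closure B \<subseteq> (\<lambda>u. dual_apply u d) -` {..c}"
    using d(1) by (intro closure_minimal) auto
  with d(2) show "v \<notin> closure B" by auto
qed

section \<open>Conjugates and the Fenchel--Moreau theorem\<close>

lemma GammaD:
  assumes "h \<in> Gamma"
  shows "\<forall>x. h x \<noteq> - \<infinity>" "epi h \<noteq> {}" "convex (epi h)" "closed (epi h)"
proof -
  show "\<forall>x. h x \<noteq> - \<infinity>" "convex (epi h)" using assms by (auto simp: Gamma_def proper_def)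
  obtain y where "h y \<noteq> \<infinity>" "h y \<noteq> - \<infinity>" using assms by (auto simp: Gamma_def proper_def)
  then obtain r where "h y = ereal r" by (cases "h y") auto
  then have "(y, r) \<in> epi h" by (simp add: epi_def)
  then show "epi h \<noteq> {}" by blast
  have "- epi h = (\<Union>q::real. {x. ereal q < h x} \<times> {..<q})"
  proof (intro set_eqI iffI)
    fix p assume "p \<in> - epi h"
    then obtain x r where p: "p = (x, r)" "ereal r < h x" by (cases p) (auto simp: epi_def)
    then obtain q where "r < q" "ereal q < h x"
      using ereal_dense2[of "ereal r" "h x"] by auto
    with p show "p \<in> (\<Union>q::real. {x. ereal q < h x} \<times> {..<q})" by auto
  next
    fix p assume "p \<in> (\<Union>q::real. {x. ereal q < h x} \<times> {..<q})"
    then obtain x r q where "p = (x, r)" "ereal q < h x" "r < q" by auto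
    moreover from this have "ereal r < h x" using less_trans[of "ereal r" "ereal q" "h x"] by simp
    ultimately show "p \<in> - epi h" by (auto simp: epi_def)
  qed
  moreover have "open (\<Union>q::real. {x. ereal q < h x} \<times> {..<q})"
    using assms by (intro open_UN ballI open_Times) (auto simp: Gamma_def lsc_def)
  ultimately show "closed (epi h)" by (simp add: closed_def)
qed

lemma fst_epi: "fst ` epi g = dom g"
proof (intro set_eqI iffI)
  fix x assume "x \<in> dom g"
  then obtain r where "g x \<le> ereal r" by (cases "g x") (auto simp: dom_def)
  then show "x \<in> fst ` epi g" by (force simp: epi_def)
qed (auto simp: epi_def dom_def)

lemma epi_conjugate_iff:
  assumes "\<forall>x. h x \<noteq> - \<infinity>"
  shows "(u, r) \<in> epi (conjugate h) \<longleftrightarrow> (\<forall>(x, s)\<in>epi h. dual_apply u x - s \<le> r)"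
proof -
  have "ereal (dual_apply u x) - h x \<le> ereal r \<longleftrightarrow> (\<forall>s. h x \<le> ereal s \<longrightarrow> dual_apply u x - s \<le> r)" for x
  proof (cases "h x")
    case (real t)
    then have "ereal (dual_apply u x) - h x \<le> ereal r \<longleftrightarrow> dual_apply u x - t \<le> r" by simp
    also have "\<dots> \<longleftrightarrow> (\<forall>s. t \<le> s \<longrightarrow> dual_apply u x - s \<le> r)" by (auto intro: order_trans[rotated])
    finally show ?thesis by (simp add: real)
  qed (use assms in auto)
  then show ?thesis
    unfolding epi_def conjugate_def by (auto simp: SUP_le_iff)
qed

lemma convex_epi_conjugate:
  assumes "\<forall>x. h x \<noteq> - \<infinity>"
  shows "convex (epi (conjugate h))"
  unfolding convex_def
proof (intro ballI allI impI)
  fix p q :: "'a dual \<times> real" and \<mu> \<nu> :: real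
  assume p: "p \<in> epi (conjugate h)" and q: "q \<in> epi (conjugate h)"
    and \<mu>: "0 \<le> \<mu>" "0 \<le> \<nu>" "\<mu> + \<nu> = 1"
  have "(\<mu> *\<^sub>R fst p + \<nu> *\<^sub>R fst q, \<mu> * snd p + \<nu> * snd q) \<in> epi (conjugate h)"
    unfolding epi_conjugate_iff[OF assms]
  proof safe
    fix x s assume "(x, s) \<in> epi h"
    with p q have "dual_apply (fst p) x - s \<le> snd p" "dual_apply (fst q) x - s \<le> snd q"
      using epi_conjugate_iff[OF assms, of "fst p" "snd p"]
        epi_conjugate_iff[OF assms, of "fst q" "snd q"] by auto
    then have "\<mu> * (dual_apply (fst p) x - s) + \<nu> * (dual_apply (fst q) x - s) \<le> \<mu> * snd p + \<nu> * snd q"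
      using \<mu> by (intro add_mono mult_left_mono) auto
    moreover have "\<mu> * s + \<nu> * s = s" using \<mu>(3) by (metis distrib_right mult_1)
    ultimately show "dual_apply (\<mu> *\<^sub>R fst p + \<nu> *\<^sub>R fst q) x - s \<le> \<mu> * snd p + \<nu> * snd q"
      by (simp add: algebra_simps)
  qed
  then show "\<mu> *\<^sub>R p + \<nu> *\<^sub>R q \<in> epi (conjugate h)"
    by (cases p; cases q) simp
qed

text \<open>
  The coefficient of the vertical direction is nonpositive because epigraphs are unbounded above.
\<close>

lemma Gamma_separation:
  fixes h :: "'a::locally_convex_t2 \<Rightarrow> ereal"
  assumes h: "h \<in> Gamma" and "(x, c) \<notin> epi h"
  obtains u b \<gamma> where "b \<le> 0" "\<forall>(y, s)\<in>epi h. dual_apply u y + b * s \<le> \<gamma>"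
    "\<gamma> < dual_apply u x + b * c"
proof -
  note G = GammaD[OF h]
  have "(x, c) \<notin> closure (epi h)" using assms(2) G(4) by simp
  then obtain u b \<gamma> where sep: "\<forall>(y, s)\<in>epi h. dual_apply u y + b * s \<le> \<gamma>"
    "\<gamma> < dual_apply u x + b * c"
    by (rule product_separation[OF G(3)])
  have "b \<le> 0"
  proof (rule ccontr)
    assume "\<not> b \<le> 0"
    obtain y s where y: "(y, s) \<in> epi h" using G(2) by auto
    define t where "t = max s ((\<gamma> - dual_apply u y + 1) / b)"
    have "(y, t) \<in> epi h"
      using y by (auto simp: epi_def t_def intro: order_trans)
    then have "dual_apply u y + b * t \<le> \<gamma>" using sep(1) by blast
    moreover have "b * ((\<gamma> - dual_apply u y + 1) / b) \<le> b * t"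
      using \<open>\<not> b \<le> 0\<close> by (intro mult_left_mono) (auto simp: t_def)
    ultimately show False using \<open>\<not> b \<le> 0\<close> by simp
  qed
  with sep show thesis by (rule that[rotated 1])
qed

text \<open>
  A hyperplane that is not vertical and lies below an epigraph is the graph of an affine minorant;
  affine minorants are the points of the epigraph of the conjugate.
\<close>

lemma epi_conjugate_of_nonvertical:
  assumes h: "h \<in> Gamma" and b: "b < 0" and "\<forall>(y, s)\<in>epi h. dual_apply u y + b * s \<le> \<gamma>"
  shows "((1 / - b) *\<^sub>R u, \<gamma> / - b) \<in> epi (conjugate h)"
  unfolding epi_conjugate_iff[OF GammaD(1)[OF h]]
proof safe
  fix y s assume "(y, s) \<in> epi h"
  then have "dual_apply u y + b * s \<le> \<gamma>" using assms(3) by blast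
  then have "(dual_apply u y + b * s) / - b \<le> \<gamma> / - b" using b by (intro divide_right_mono) auto
  then show "dual_apply ((1 / - b) *\<^sub>R u) y - s \<le> \<gamma> / - b"
    using b by (simp add: add_divide_distrib)
qed

text \<open>
  A point just below the graph, over the effective domain, cannot be separated from the epigraph
  by a vertical hyperplane.
\<close>

lemma epi_conjugate_nonempty:
  fixes h :: "'a::locally_convex_t2 \<Rightarrow> ereal"
  assumes h: "h \<in> Gamma"
  shows "epi (conjugate h) \<noteq> {}"
proof -
  obtain x s where x: "(x, s) \<in> epi h" using GammaD(2)[OF h] by auto
  have "\<exists>c. (x, c) \<notin> epi h"
  proof (cases "h x")
    case (real t)
    then show ?thesis by (intro exI[of _ "t - 1"]) (simp add: epi_def)
  qed (use x GammaD(1)[OF h] in \<open>auto simp: epi_def\<close>)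
  then obtain c where "(x, c) \<notin> epi h" by blast
  then obtain u b \<gamma> where sep: "b \<le> 0" "\<forall>(y, s)\<in>epi h. dual_apply u y + b * s \<le> \<gamma>"
    "\<gamma> < dual_apply u x + b * c"
    by (rule Gamma_separation[OF h])
  have "b \<noteq> 0" using sep x by fastforce
  then show ?thesis using epi_conjugate_of_nonvertical[OF h _ sep(2)] sep(1) by auto
qed

text \<open>
  The identity \<open>h = h**\<close> in terms of epigraphs. A point below the graph is cut off by a
  hyperplane. If that hyperplane is vertical, adding a large multiple of it to any affine minorant
  \<open>(u0, r0)\<close> still gives a minorant, whose value at \<open>x\<close> is as large as desired.
\<close>

theorem Fenchel_Moreau_epi:
  fixes h :: "'a::locally_convex_t2 \<Rightarrow> ereal"
  assumes h: "h \<in> Gamma"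
  shows "(x, c) \<in> epi h \<longleftrightarrow> (\<forall>(u, r)\<in>epi (conjugate h). dual_apply u x - r \<le> c)"
proof
  assume "(x, c) \<in> epi h"
  then show "\<forall>(u, r)\<in>epi (conjugate h). dual_apply u x - r \<le> c"
    using epi_conjugate_iff[OF GammaD(1)[OF h]] by fastforce
next
  assume le: "\<forall>(u, r)\<in>epi (conjugate h). dual_apply u x - r \<le> c"
  show "(x, c) \<in> epi h"
  proof (rule ccontr)
    assume "(x, c) \<notin> epi h"
    then obtain u b \<gamma> where sep: "b \<le> 0" "\<forall>(y, s)\<in>epi h. dual_apply u y + b * s \<le> \<gamma>"
      "\<gamma> < dual_apply u x + b * c"
      by (rule Gamma_separation[OF h])
    show False
    proof (cases "b = 0")
      case False
      with sep(1) have b: "b < 0" by simp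
      have "dual_apply ((1 / - b) *\<^sub>R u) x - \<gamma> / - b \<le> c"
        using le epi_conjugate_of_nonvertical[OF h b sep(2)] by blast
      then have "(dual_apply u x - \<gamma>) / - b \<le> c" by (simp add: diff_divide_distrib)
      then show False using b sep(3) by (simp add: field_simps)
    next
      case True
      obtain u0 r0 where u0: "(u0, r0) \<in> epi (conjugate h)"
        using epi_conjugate_nonempty[OF h] by auto
      define g where "g = dual_apply u x - \<gamma>"
      have g: "g > 0" using sep(3) True by (simp add: g_def)
      define t where "t = (\<bar>c - dual_apply u0 x + r0\<bar> + 1) / g"
      have t: "t > 0" "t * g > c - dual_apply u0 x + r0" using g by (auto simp: t_def)
      have "(u0 + t *\<^sub>R u, r0 + t * \<gamma>) \<in> epi (conjugate h)"
        unfolding epi_conjugate_iff[OF GammaD(1)[OF h]]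
      proof safe
        fix y s assume y: "(y, s) \<in> epi h"
        have "dual_apply u0 y - s \<le> r0"
          using u0 y epi_conjugate_iff[OF GammaD(1)[OF h], of u0 r0] by auto
        moreover have "t * dual_apply u y \<le> t * \<gamma>"
          using sep(2) y True t(1) by (intro mult_left_mono) auto
        ultimately show "dual_apply (u0 + t *\<^sub>R u) y - s \<le> r0 + t * \<gamma>" by simp
      qed
      then have "dual_apply (u0 + t *\<^sub>R u) x - (r0 + t * \<gamma>) \<le> c" using le by blast
      then show False using t(2) by (simp add: g_def algebra_simps)
    qed
  qed
qed

section \<open>Recession functions as support functions\<close>

text \<open>
  Along a ray, an affine minorant of \<open>h\<close> with slope \<open>u\<close> grows at rate \<open>dual_apply u d\<close>; and \<open>h\<close> is the
  supremum of these minorants. The starting point of the ray does not occur on the right-hand side.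
\<close>

theorem ray_in_epi_iff_support:
  fixes h :: "'a::locally_convex_t2 \<Rightarrow> ereal"
  assumes h: "h \<in> Gamma" and a: "(a, \<alpha>) \<in> epi h"
  shows "(\<forall>s>0. (a + s *\<^sub>R d, \<alpha> + s * r) \<in> epi h) \<longleftrightarrow> (\<forall>u\<in>dom (conjugate h). dual_apply u d \<le> r)"
proof (intro iffI ballI allI impI)
  fix u assume rec: "\<forall>s>0. (a + s *\<^sub>R d, \<alpha> + s * r) \<in> epi h" and "u \<in> dom (conjugate h)"
  then obtain \<rho> where u: "(u, \<rho>) \<in> epi (conjugate h)" by (auto simp flip: fst_epi)
  have "s * (dual_apply u d - r) \<le> \<rho> + \<alpha> - dual_apply u a" if "s > 0" for s
  proof -
    have "dual_apply u (a + s *\<^sub>R d) - (\<alpha> + s * r) \<le> \<rho>"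
      using rec that u epi_conjugate_iff[OF GammaD(1)[OF h], of u \<rho>] by blast
    then show ?thesis by (simp add: algebra_simps)
  qed
  then have "dual_apply u d - r \<le> 0" by (rule nonpos_if_multiples_bounded)
  then show "dual_apply u d \<le> r" by simp
next
  fix s :: real
  assume sup: "\<forall>u\<in>dom (conjugate h). dual_apply u d \<le> r" and "s > 0"
  show "(a + s *\<^sub>R d, \<alpha> + s * r) \<in> epi h"
    unfolding Fenchel_Moreau_epi[OF h]
  proof safe
    fix u \<rho> assume u: "(u, \<rho>) \<in> epi (conjugate h)"
    then have "u \<in> dom (conjugate h)" by (force simp flip: fst_epi)
    then have "s * dual_apply u d \<le> s * r" using sup \<open>s > 0\<close> by (intro mult_left_mono) auto
    moreover have "dual_apply u a - \<rho> \<le> \<alpha>" using a u Fenchel_Moreau_epi[OF h] by blast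
    ultimately show "dual_apply u (a + s *\<^sub>R d) - \<rho> \<le> \<alpha> + s * r" by simp
  qed
qed

text \<open>
  The recession function of \<open>h\<close> is the support function of the domain of its conjugate.
\<close>

corollary recession_function_le_iff_support:
  fixes h :: "'a::locally_convex_t2 \<Rightarrow> ereal"
  assumes h: "h \<in> Gamma"
  shows "recession_function h d \<le> ereal r \<longleftrightarrow> (\<forall>u\<in>dom (conjugate h). dual_apply u d \<le> r)"
proof -
  obtain a \<alpha> where p: "(SOME p. p \<in> epi h) = (a, \<alpha>)" by fastforce
  then have a: "(a, \<alpha>) \<in> epi h" using GammaD(2)[OF h] by (metis some_in_eq)
  have "recession_function h d \<le> ereal r \<longleftrightarrow> (d, r) \<in> recession_cone (epi h)"
    unfolding epi_recession_function[symmetric] by (simp add: epi_def)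
  also have "\<dots> \<longleftrightarrow> (\<forall>s>0. (a, \<alpha>) + s *\<^sub>R (d, r) \<in> epi h)"
    unfolding recession_cone_def Let_def p by (rule mem_scaled_translates_iff)
  also have "\<dots> \<longleftrightarrow> (\<forall>u\<in>dom (conjugate h). dual_apply u d \<le> r)"
    using ray_in_epi_iff_support[OF h a] by simp
  finally show ?thesis .
qed

corollary recession_function_le_iff:
  fixes h :: "'a::locally_convex_t2 \<Rightarrow> ereal"
  assumes h: "h \<in> Gamma" and a: "(a, \<alpha>) \<in> epi h"
  shows "recession_function h d \<le> ereal r \<longleftrightarrow> (\<forall>s>0. (a + s *\<^sub>R d, \<alpha> + s * r) \<in> epi h)"
  unfolding recession_function_le_iff_support[OF h] ray_in_epi_iff_support[OF h a] by (rule refl)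

lemma epi_delta: "epi (delta D) = D \<times> {0..}"
  by (auto simp: epi_def delta_def split: if_splits)

lemma delta_in_Gamma:
  fixes D :: "'a::real_tvs set"
  assumes "D \<noteq> {}" "closed D" "convex D"
  shows "delta D \<in> Gamma"
proof -
  have "open {x. c < delta D x}" for c
  proof (cases "c < 0")
    case True
    then have "{x. c < delta D x} = UNIV" by (auto simp: delta_def intro: less_le_trans)
    then show ?thesis by simp
  next
    case False
    then have "{x. c < delta D x} = (if c = \<infinity> then {} else - D)" by (auto simp: delta_def)
    then show ?thesis using assms(2) by auto
  qed
  moreover have "convex (epi (delta D))"
    using assms(3) by (simp add: epi_delta convex_Times)
  ultimately show ?thesis
    using assms(1) by (auto simp: Gamma_def proper_def lsc_def delta_def)
qed

text \<open>
  Through this equivalence, the constraint \<open>x \<in> D\<close> is treated like the constraints given by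
  functions.
\<close>

lemma recession_cone_iff_recession_function_delta:
  fixes D :: "'a::locally_convex_t2 set"
  assumes D: "D \<noteq> {}" "closed D" "convex D"
  shows "d \<in> recession_cone D \<longleftrightarrow> recession_function (delta D) d \<le> 0"
proof -
  obtain a where a: "a \<in> D" using D(1) by blast
  then have "(a, 0) \<in> epi (delta D)" by (simp add: epi_delta)
  from recession_function_le_iff[OF delta_in_Gamma[OF D] this, of d 0]
  show ?thesis
    unfolding recession_cone_eq[OF D(2,3) a] mem_scaled_translates_iff
    by (simp add: epi_delta zero_ereal_def)
qed

lemma epi_conjugate_delta_iff:
  "(v, t) \<in> epi (conjugate (delta D)) \<longleftrightarrow> (\<forall>y\<in>D. dual_apply v y \<le> t)"
proof -
  have "\<forall>x. delta D x \<noteq> - \<infinity>" by (simp add: delta_def)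
  then have "(v, t) \<in> epi (conjugate (delta D)) \<longleftrightarrow> (\<forall>y\<in>D. \<forall>s\<ge>0. dual_apply v y - s \<le> t)"
    by (auto simp: epi_conjugate_iff epi_delta)
  also have "\<dots> \<longleftrightarrow> (\<forall>y\<in>D. dual_apply v y \<le> t)"
  proof (intro iffI ballI allI impI)
    fix y assume "\<forall>y\<in>D. \<forall>s\<ge>0. dual_apply v y - s \<le> t" "y \<in> D"
    then have "dual_apply v y - 0 \<le> t" by blast
    then show "dual_apply v y \<le> t" by simp
  qed (force intro: order_trans[rotated])
  finally show ?thesis .
qed

lemma barr_iff: "v \<in> barr D \<longleftrightarrow> (\<exists>t. \<forall>y\<in>D. dual_apply v y \<le> t)"
  unfolding barr_def fst_epi[symmetric] epi_conjugate_delta_iff[symmetric] by force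

lemma convex_cone_barr: "convex_cone (barr D)"
  unfolding convex_cone_iff
proof (intro conjI ballI allI impI)
  show "0 \<in> barr D" unfolding barr_iff by auto
next
  fix u v assume "u \<in> barr D" "v \<in> barr D"
  then obtain s t where "\<forall>y\<in>D. dual_apply u y \<le> s" "\<forall>y\<in>D. dual_apply v y \<le> t"
    unfolding barr_iff by blast
  then show "u + v \<in> barr D"
    unfolding barr_iff by (intro exI[of _ "s + t"]) (auto intro: add_mono)
next
  fix u and c :: real assume "u \<in> barr D" "0 \<le> c"
  then obtain s where "\<forall>y\<in>D. dual_apply u y \<le> s" unfolding barr_iff by blast
  then show "c *\<^sub>R u \<in> barr D"
    unfolding barr_iff using \<open>0 \<le> c\<close>
    by (intro exI[of _ "c * s"]) (auto intro: mult_left_mono)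
qed

section \<open>Generated cones\<close>

lemma convex_cone_gen_cone: "convex_cone (gen_cone D)"
  by (simp add: gen_cone_def convex_cone_convex_cone_hull)

lemma gen_cone_superset: "D \<subseteq> gen_cone D"
  unfolding gen_cone_def by (meson hull_subset insert_subset)

lemma nonpos_on_gen_cone_iff:
  assumes "linear l"
  shows "(\<forall>k\<in>gen_cone D. l k \<le> (0::real)) \<longleftrightarrow> (\<forall>k\<in>D. l k \<le> 0)"
proof (intro iffI)
  assume "\<forall>k\<in>D. l k \<le> 0"
  moreover have "convex_cone {k. l k \<le> 0}"
    using assms unfolding convex_cone_iff
    by (auto simp: linear_0 linear_add linear_cmul mult_nonneg_nonpos)
  ultimately have "gen_cone D \<subseteq> {k. l k \<le> 0}"
    unfolding gen_cone_def using assms by (intro hull_minimal) (auto simp: linear_0)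
  then show "\<forall>k\<in>gen_cone D. l k \<le> 0" by blast
qed (use gen_cone_superset[of D] in blast)

text \<open>
  Moving along a ray of the cone would make a positive value of \<open>l\<close> exceed any bound.
\<close>

lemma bounded_on_plus_cone_iff:
  assumes l: "linear l" and K: "convex_cone K" and P: "P \<noteq> {}"
  shows "(\<forall>x\<in>P + K. l x \<le> (c::real)) \<longleftrightarrow> (\<forall>p\<in>P. l p \<le> c) \<and> (\<forall>k\<in>K. l k \<le> 0)"
proof (intro iffI conjI ballI)
  assume le: "\<forall>x\<in>P + K. l x \<le> c"
  show "l p \<le> c" if "p \<in> P" for p
    using le set_plus_intro[OF that convex_cone_contains_0[OF K]] by simp
  fix k assume k: "k \<in> K"
  obtain p where p: "p \<in> P" using P by blast
  have "s * l k \<le> c - l p" if "s > 0" for s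
  proof -
    have "p + s *\<^sub>R k \<in> P + K"
      using p convex_cone_scaleR[OF K _ k] that by (intro set_plus_intro) auto
    then show ?thesis using le by (force simp: linear_add[OF l] linear_cmul[OF l])
  qed
  then show "l k \<le> 0" by (rule nonpos_if_multiples_bounded)
next
  fix x assume "(\<forall>p\<in>P. l p \<le> c) \<and> (\<forall>k\<in>K. l k \<le> 0)" "x \<in> P + K"
  then show "l x \<le> c" by (force simp: set_plus_def linear_add[OF l])
qed

lemma gen_cone_Un_cone:
  assumes "convex_cone K"
  shows "gen_cone (D \<union> K) = gen_cone D + K"
proof -
  have "gen_cone (D \<union> K) = convex_cone hull (insert 0 D \<union> K)"
    by (simp add: gen_cone_def)
  also have "\<dots> = gen_cone D + K"
    unfolding convex_cone_hull_Un gen_cone_def hull_same[where S = convex_cone, OF assms]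
    by (auto simp: set_plus_def)
  finally show ?thesis .
qed

lemma gen_cone_linear_image: "linear l \<Longrightarrow> l ` gen_cone D = gen_cone (l ` D)"
  by (simp add: gen_cone_def linear_0 flip: convex_cone_hull_linear_image)

text \<open>
  Forgetting the second component turns epigraphs into effective domains, and generated cones
  commute with linear maps.
\<close>

lemma fst_char_cone:
  "fst ` char_cone C I fs = gen_cone (conj_doms I fs) + barr C"
proof -
  have "fst ` char_cone C I fs = gen_cone (conj_doms I fs \<union> barr C)"
    unfolding char_cone_def gen_cone_linear_image[OF linear_fst] image_Un image_UN fst_epi
      conj_doms_def barr_def by (simp add: Un_commute)
  then show ?thesis by (simp add: gen_cone_Un_cone convex_cone_barr)
qed

section \<open>Infeasible convex systems\<close>

locale infeasible_convex_system =
  fixes C :: "'a::locally_convex_t2 set"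
    and I :: "'i set"
    and fs :: "'i \<Rightarrow> 'a \<Rightarrow> ereal"
    and f :: "'a \<Rightarrow> ereal"
  assumes C: "C \<noteq> {}" "closed C" "convex C"
    and fs: "\<And>i. i \<in> I \<Longrightarrow> fs i \<in> Gamma"
    and f: "f \<in> Gamma"
    and infeasible: "feasible C I fs \<inter> dom f = {}"
begin

lemma convex_cone_char_cone: "convex_cone (char_cone C I fs)"
  by (simp add: char_cone_def convex_cone_gen_cone)

lemma convex_epi_plus_char_cone: "convex (epi (conjugate f) + char_cone C I fs)"
  using convex_cone_char_cone
  by (intro convex_set_plus convex_epi_conjugate GammaD(1)[OF f]) (simp add: convex_cone_def)

lemma fst_epi_plus_char_cone:
  "fst ` (epi (conjugate f) + char_cone C I fs)
    = dom (conjugate f) + gen_cone (conj_doms I fs) + barr C" (is "fst ` (?P + ?K) = _")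
proof -
  have "fst ` (?P + ?K) = fst ` ?P + fst ` ?K"
    by (force simp: set_plus_def image_iff)
  then show ?thesis by (simp add: fst_epi fst_char_cone add.assoc)
qed

lemma epi_conjugate_infeasible: "epi (conjugate (\<lambda>x. f x + delta (feasible C I fs) x)) = UNIV"
proof -
  have "(\<lambda>x. f x + delta (feasible C I fs) x) = (\<lambda>_. \<infinity>)"
    using infeasible GammaD(1)[OF f] by (auto simp: dom_def delta_def fun_eq_iff)
  then show ?thesis by (simp add: epi_def conjugate_def)
qed

lemma epi_conjugate_delta_subset_char_cone: "epi (conjugate (delta C)) \<subseteq> char_cone C I fs"
  and epi_conjugate_subset_char_cone: "i \<in> I \<Longrightarrow> epi (conjugate (fs i)) \<subseteq> char_cone C I fs"
  unfolding char_cone_def by (rule order_trans[OF _ gen_cone_superset], blast)+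

text \<open>
  This is where infeasibility enters. By the Fenchel--Moreau theorem, a nonvertical hyperplane bounding
  \<open>epi (conjugate f) + char_cone C I fs\<close> would be given by a point \<open>e\<close> with \<open>f e < \<infinity>\<close>, \<open>e \<in> C\<close>
  and \<open>fs i e \<le> 0\<close> for all \<open>i\<close>.
\<close>

lemma no_nonvertical_bound:
  assumes "b < 0"
    and "\<forall>(u, s)\<in>epi (conjugate f). dual_apply u d + b * s \<le> c"
    and "\<forall>(v, t)\<in>char_cone C I fs. dual_apply v d + b * t \<le> 0"
  shows False
proof -
  define e where "e = (1 / - b) *\<^sub>R d"
  have scale: "dual_apply u e - s \<le> q / - b" if "dual_apply u d + b * s \<le> q" for u s q
  proof -
    have "(dual_apply u d + b * s) / - b \<le> q / - b"
      using that assms(1) by (intro divide_right_mono) auto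
    then show ?thesis using assms(1) by (simp add: e_def add_divide_distrib)
  qed
  have "(e, c / - b) \<in> epi f"
    unfolding Fenchel_Moreau_epi[OF f] using assms(2) by (intro ballI case_prodI2 scale) auto
  then have "e \<in> dom f" by (force simp flip: fst_epi)
  moreover have K: "\<forall>(v, t)\<in>char_cone C I fs. dual_apply v e - t \<le> 0"
    using assms(3) scale[where q = 0] by auto
  have "(e, 0) \<in> epi (delta C)"
    unfolding Fenchel_Moreau_epi[OF delta_in_Gamma[OF C]]
    using K epi_conjugate_delta_subset_char_cone by blast
  then have "e \<in> C" by (simp add: epi_delta)
  moreover have "(e, 0) \<in> epi (fs i)" if "i \<in> I" for i
    unfolding Fenchel_Moreau_epi[OF fs[OF that]]
    using K epi_conjugate_subset_char_cone[OF that] by blast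
  ultimately have "e \<in> feasible C I fs \<inter> dom f"
    by (auto simp: feasible_def epi_def zero_ereal_def)
  then show False using infeasible by blast
qed

text \<open>
  All hyperplanes bounding the sum are vertical, so its closure is determined by its projection: it
  contains the line over \<open>xs\<close> as soon as \<open>xs\<close> lies in the closure of the projection.
\<close>

lemma vertical_line_iff:
  "{xs} \<times> UNIV \<subseteq> closure (epi (conjugate f) + char_cone C I fs)
    \<longleftrightarrow> xs \<in> closure (dom (conjugate f) + gen_cone (conj_doms I fs) + barr C)"
  (is "_ \<subseteq> closure ?E \<longleftrightarrow> xs \<in> closure ?B")
proof
  assume "{xs} \<times> UNIV \<subseteq> closure ?E"
  then have "(xs, 0) \<in> closure ?E" by blast
  moreover have "closed (fst -` closure ?B :: ('a dual \<times> real) set)"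
    by (intro closed_vimage continuous_on_fst continuous_on_id) simp
  then have "closure ?E \<subseteq> fst -` closure ?B"
    using closure_subset[of ?B] fst_epi_plus_char_cone by (intro closure_minimal) auto
  ultimately show "xs \<in> closure ?B" by auto
next
  assume xs: "xs \<in> closure ?B"
  show "{xs} \<times> UNIV \<subseteq> closure ?E"
  proof (rule ccontr)
    assume "\<not> {xs} \<times> UNIV \<subseteq> closure ?E"
    then obtain r where "(xs, r) \<notin> closure ?E" by blast
    then obtain d b c where sep: "\<forall>(u, s)\<in>?E. dual_apply u d + b * s \<le> c"
      "c < dual_apply xs d + b * r"
      by (rule weak_star_product_separation[OF convex_epi_plus_char_cone])
    define l where "l p = dual_apply (fst p) d + b * snd p" for p :: "'a dual \<times> real"
    have "linear l" by (rule linearI) (auto simp: l_def algebra_simps)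
    moreover have "\<forall>p\<in>?E. l p \<le> c" using sep(1) by (auto simp: l_def)
    ultimately have l: "\<forall>p\<in>epi (conjugate f). l p \<le> c" "\<forall>k\<in>char_cone C I fs. l k \<le> 0"
      using bounded_on_plus_cone_iff[OF _ convex_cone_char_cone epi_conjugate_nonempty[OF f]]
      by blast+
    \<comment> \<open>The cone contains the upward vertical direction, which fixes the sign of \<open>b\<close>.\<close>
    have "(0, 1) \<in> epi (conjugate (delta C))" by (simp add: epi_conjugate_delta_iff)
    then have "l (0, 1) \<le> 0" using l(2) epi_conjugate_delta_subset_char_cone by blast
    then have b: "b \<le> 0" by (simp add: l_def)
    have "\<not> b < 0" using no_nonvertical_bound[of b d c] l by (auto simp: l_def case_prod_unfold)
    with b have "b = 0" by simp
    with sep have "\<forall>u\<in>?B. dual_apply u d \<le> c" "c < dual_apply xs d"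
      unfolding fst_epi_plus_char_cone[symmetric] by auto
    moreover have "convex ?B"
      unfolding fst_epi_plus_char_cone[symmetric]
      by (intro convex_linear_image linear_fst convex_epi_plus_char_cone)
    ultimately show False using xs not_in_weak_star_closure_iff by blast
  qed
qed

text \<open>
  A point \<open>d\<close> separating \<open>xs\<close> from the sum is bounded on \<open>dom (conjugate f)\<close> and nonpositive on
  the cone. Read through support functions, the bound is a bound on the recession function of \<open>f\<close>
  at \<open>d\<close>, and nonpositivity says that \<open>d\<close> is a recession direction of \<open>C\<close> and of all sublevel
  sets of the \<open>fs i\<close>.
\<close>

lemma not_in_closure_iff_recession_direction:
  "xs \<notin> closure (dom (conjugate f) + gen_cone (conj_doms I fs) + barr C)
    \<longleftrightarrow> (\<exists>d \<in> (\<Inter>i\<in>I. {d. recession_function (fs i) d \<le> 0}) \<inter> recession_cone C.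
        recession_function f d < ereal (dual_apply xs d))"
  (is "xs \<notin> closure ?B \<longleftrightarrow> (\<exists>d \<in> ?D. _)")
proof -
  let ?K = "gen_cone (conj_doms I fs \<union> barr C)"
  have B: "?B = dom (conjugate f) + ?K"
    by (simp add: gen_cone_Un_cone convex_cone_barr add.assoc)
  have "convex ?B"
    unfolding fst_epi_plus_char_cone[symmetric]
    by (intro convex_linear_image linear_fst convex_epi_plus_char_cone)
  have ne: "dom (conjugate f) \<noteq> {}"
    using epi_conjugate_nonempty[OF f] by (simp flip: fst_epi)
  have lin: "linear (\<lambda>u. dual_apply u d)" for d :: 'a by (rule linearI) auto
  have D: "d \<in> ?D \<longleftrightarrow> (\<forall>v\<in>?K. dual_apply v d \<le> 0)" for d
    using recession_function_le_iff_support[OF fs, of _ d 0]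
      recession_function_le_iff_support[OF delta_in_Gamma[OF C], of d 0]
    unfolding nonpos_on_gen_cone_iff[OF lin]
    by (auto simp: recession_cone_iff_recession_function_delta[OF C] barr_def conj_doms_def
        simp flip: zero_ereal_def)
  have "xs \<notin> closure ?B \<longleftrightarrow>
      (\<exists>d r. (\<forall>u\<in>?B. dual_apply u d \<le> r) \<and> r < dual_apply xs d)"
    by (rule not_in_weak_star_closure_iff[OF \<open>convex ?B\<close>])
  also have "\<dots> \<longleftrightarrow> (\<exists>d r. d \<in> ?D \<and> recession_function f d \<le> ereal r \<and> r < dual_apply xs d)"
    unfolding B bounded_on_plus_cone_iff[OF lin convex_cone_gen_cone ne] D
      recession_function_le_iff_support[OF f] by blast
  also have "\<dots> \<longleftrightarrow> (\<exists>d\<in>?D. recession_function f d < ereal (dual_apply xs d))"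
  proof -
    have between: "(\<exists>r. recession_function f d \<le> ereal r \<and> r < dual_apply xs d)
        \<longleftrightarrow> recession_function f d < ereal (dual_apply xs d)" for d
    proof
      assume "recession_function f d < ereal (dual_apply xs d)"
      then obtain r where "recession_function f d < ereal r" "ereal r < ereal (dual_apply xs d)"
        using ereal_dense2 by blast
      then show "\<exists>r. recession_function f d \<le> ereal r \<and> r < dual_apply xs d"
        by (intro exI[of _ r]) auto
    qed (auto intro: le_less_trans)
    show ?thesis by (simp only: Bex_def ex_simps flip: between)
  qed
  finally show ?thesis .
qed

text \<open>
  Rays are tested from one feasible point \<open>a\<close>. Since \<open>fs i a \<le> 0\<close>, the point \<open>(a, 0)\<close> lies in the
  epigraph of \<open>fs i\<close>, so membership of the ray in the sublevel set is membership of a horizontal ray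
  in the epigraph.
\<close>

lemma recession_cone_feasible:
  assumes "feasible C I fs \<noteq> {}"
  shows "recession_cone (feasible C I fs)
    = (\<Inter>i\<in>I. {d. recession_function (fs i) d \<le> 0}) \<inter> recession_cone C"
proof -
  define a where "a = (SOME a. a \<in> feasible C I fs)"
  have "a \<in> feasible C I fs" unfolding a_def using assms by (simp add: some_in_eq)
  then have a: "a \<in> C" "\<And>i. i \<in> I \<Longrightarrow> (a, 0) \<in> epi (fs i)"
    by (auto simp: feasible_def epi_def zero_ereal_def)
  have "d \<in> recession_cone (feasible C I fs) \<longleftrightarrow> (\<forall>s>0. a + s *\<^sub>R d \<in> feasible C I fs)" for d
    unfolding recession_cone_def Let_def a_def[symmetric] by (rule mem_scaled_translates_iff)
  moreover have "d \<in> recession_cone C \<longleftrightarrow> (\<forall>s>0. a + s *\<^sub>R d \<in> C)" for d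
    unfolding recession_cone_eq[OF C(2,3) a(1)] by (rule mem_scaled_translates_iff)
  moreover have "recession_function (fs i) d \<le> 0 \<longleftrightarrow> (\<forall>s>0. fs i (a + s *\<^sub>R d) \<le> 0)" if "i \<in> I" for i d
    using recession_function_le_iff[OF fs[OF that] a(2)[OF that], of d 0]
    by (simp add: epi_def zero_ereal_def)
  ultimately show ?thesis by (auto simp: feasible_def)
qed

end

theorem theorem4p4:
  fixes C :: "'a::locally_convex_t2 set"
    and I :: "'i set"
    and fs :: "'i \<Rightarrow> 'a \<Rightarrow> ereal"
    and f :: "'a \<Rightarrow> ereal"
    and xs :: "'a dual"
  defines "A \<equiv> feasible C I fs"
    and "K \<equiv> char_cone C I fs"
    and "\<Omega> \<equiv> conj_doms I fs"
  defines "cond_i \<equiv>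
      epi (conjugate (\<lambda>x. f x + delta A x)) \<inter> ({xs} \<times> UNIV)
        \<noteq> closure (epi (conjugate f) + K) \<inter> ({xs} \<times> UNIV)"
    and "cond_ii \<equiv> \<not> ({xs} \<times> UNIV \<subseteq> closure (epi (conjugate f) + K))"
    and "cond_iii \<equiv> xs \<notin> closure (dom (conjugate f) + gen_cone \<Omega> + barr C)"
    and "cond_iv \<equiv>
      (\<exists>d \<in> (\<Inter>i\<in>I. {d. recession_function (fs i) d \<le> 0}) \<inter> recession_cone C.
        recession_function f d < ereal (dual_apply xs d))"
    and "cond_v \<equiv>
      (\<exists>d \<in> recession_cone A. recession_function f d < ereal (dual_apply xs d))"
  assumes "C \<noteq> {}" "closed C" "convex C"
    and "\<And>i. i \<in> I \<Longrightarrow> fs i \<in> Gamma"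
    and "f \<in> Gamma"
    and "A \<inter> dom f = {}"
  shows "(cond_i \<longleftrightarrow> cond_ii) \<and> (cond_ii \<longleftrightarrow> cond_iii) \<and> (cond_iii \<longleftrightarrow> cond_iv)
    \<and> (A \<noteq> {} \<longrightarrow> (cond_iv \<longleftrightarrow> cond_v))"
proof -
  interpret infeasible_convex_system C I fs f
    using assms(9-) unfolding A_def by unfold_locales auto
  \<comment> \<open>The function \<open>f + delta A\<close> is constantly \<open>\<infinity>\<close>, so the left-hand side of (i) is the whole line.\<close>
  have "cond_i \<longleftrightarrow> cond_ii"
    unfolding cond_i_def cond_ii_def A_def epi_conjugate_infeasible by blast
  moreover have "cond_ii \<longleftrightarrow> cond_iii"
    unfolding cond_ii_def cond_iii_def K_def \<Omega>_def vertical_line_iff by (rule refl)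
  moreover have "cond_iii \<longleftrightarrow> cond_iv"
    unfolding cond_iii_def cond_iv_def \<Omega>_def by (rule not_in_closure_iff_recession_direction)
  moreover have "cond_iv \<longleftrightarrow> cond_v" if "A \<noteq> {}"
    using recession_cone_feasible that unfolding cond_iv_def cond_v_def A_def by simp
  ultimately show ?thesis by (intro conjI impI)
qed

end
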